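(* For every odd prime $m$, integer $\beta \geq 2$, and integer $k$ with $1 \leq k \leq m-1$, the group \[ \Gamma^{2m, m^{\beta}}(3,\ 1+km^{\beta-1},\ -3,\ -1+km^{\beta-1}) \] is the automorphism group of a tight chiral polyhedron of type $\{2m, m^{\beta}\}$.
   Context: For integers $p,q,i_1,j_1,i_2,j_2$, $\Gamma^{p,q}(i_1,j_1,i_2,j_2)$ denotes the group with presentation $\langle \sigma_1,\sigma_2 \mid \sigma_1^p=\sigma_2^q=(\sigma_1\sigma_2)^2=1,\ \sigma_2^{-1}\sigma_1=\sigma_1^{i_1}\sigma_2^{j_1},\ \sigma_2\sigma_1^{-1}=\sigma_1^{i_2}\sigma_2^{j_2}\rangle$. An (abstract) polyhedron is a partially ordered set whose elements have rank $0$, $1$, $2$ (vertices, edges, faces), incidence meaning comparability, such that every edge is incident to exactly two vertices and two faces, whenever a vertex is incident to a face exactly two edges are incident to both, the incidence graph is connected, and for each vertex or face the subgraph of the incidence graph induced on its neighbours is connected. A flag is a mutually incident (vertex, edge, face) triple; $\Phi^i$ is the flag differing from $\Phi$ exactly in its rank-$i$ element. Type $\{p,q\}$: faces are incident to $p$ edges and vertices to $q$ edges. The polyhedron is chiral if its flags split into two classes with $\Phi,\Phi^i$ always in different classes and the automorphism group transitive on each class but not on all flags; then, fixing a base flag $\Phi$, the automorphism group is generated by $\sigma_1:\Phi\mapsto(\Phi^1)^0$ and $\sigma_2:\Phi\mapsto(\Phi^2)^1$. A group $\langle\sigma_1,\sigma_2\rangle$ "is the automorphism group of" such a polyhedron if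 there is an isomorphism onto it sending the generators $\sigma_1,\sigma_2$ to these distinguished generators. A polyhedron of type $\{p,q\}$ is tight if it has exactly $2pq$ flags. *)

theory Defs
  imports "HOL-Computational_Algebra.Primes" "HOL-Algebra.Bij"
begin

section \<open>Groups given by generators and relations\<close>

text \<open>The letter \<open>(x, False)\<close> stands for the generator \<open>x\<close> and \<open>(x, True)\<close> for its inverse.
  A relation \<open>l = r\<close> is the pair \<open>(l, r)\<close> of words.\<close>

type_synonym 'g word = "('g \<times> bool) list"

inductive word_eq :: "('g word \<times> 'g word) set \<Rightarrow> 'g word \<Rightarrow> 'g word \<Rightarrow> bool"
  for R :: "('g word \<times> 'g word) set" where
  refl: "word_eq R w w"
| sym: "word_eq R v w \<Longrightarrow> word_eq R w v"
| trans: "word_eq R u v \<Longrightarrow> word_eq R v w \<Longrightarrow> word_eq R u w"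
| cancel: "word_eq R (u @ [(x, b), (x, \<not> b)] @ v) (u @ v)"
| relation: "(l, r) \<in> R \<Longrightarrow> word_eq R (u @ l @ v) (u @ r @ v)"

definition word_class :: "('g word \<times> 'g word) set \<Rightarrow> 'g word \<Rightarrow> 'g word set" where
  "word_class R w = {v. word_eq R w v}"

definition presented_group :: "('g word \<times> 'g word) set \<Rightarrow> 'g word set monoid" where
  "presented_group R =
    \<lparr>carrier = range (word_class R),
     mult = (\<lambda>A B. \<Union>v\<in>A. \<Union>w\<in>B. word_class R (v @ w)),
     one = word_class R []\<rparr>"

definition presented_gen :: "('g word \<times> 'g word) set \<Rightarrow> 'g \<Rightarrow> 'g word set" where
  "presented_gen R x = word_class R [(x, False)]"

definition gen_power :: "'g \<Rightarrow> int \<Rightarrow> 'g word" where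
  "gen_power x i = replicate (nat \<bar>i\<bar>) (x, i < 0)"

lemma word_eq_context: "word_eq R v w \<Longrightarrow> word_eq R (a @ v @ b) (a @ w @ b)"
proof (induction rule: word_eq.induct)
  case (refl w)
  show ?case by (rule word_eq.refl)
next
  case (sym v w)
  from sym.IH show ?case by (rule word_eq.sym)
next
  case (trans u v w)
  from trans.IH show ?case by (rule word_eq.trans)
next
  case (cancel u x c v)
  show ?case using word_eq.cancel[of R "a @ u" x c "v @ b"] by simp
next
  case (relation l r u v)
  show ?case using word_eq.relation[OF relation, of "a @ u" "v @ b"] by simp
qed

lemma word_eq_append:
  assumes "word_eq R v v'" "word_eq R w w'"
  shows "word_eq R (v @ w) (v' @ w')"
proof (rule word_eq.trans)
  show "word_eq R (v @ w) (v' @ w)"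
    using word_eq_context[OF assms(1), of "[]" w] by simp
  show "word_eq R (v' @ w) (v' @ w')"
    using word_eq_context[OF assms(2), of v' "[]"] by simp
qed

lemma word_class_eq_iff: "word_class R v = word_class R w \<longleftrightarrow> word_eq R v w"
proof
  assume "word_class R v = word_class R w"
  then show "word_eq R v w"
    using word_eq.refl[of R w] by (auto simp: word_class_def)
next
  assume vw: "word_eq R v w"
  show "word_class R v = word_class R w"
    using word_eq.trans[OF vw] word_eq.trans[OF word_eq.sym[OF vw]] by (auto simp: word_class_def)
qed

lemma presented_group_mult:
  "word_class R v \<otimes>\<^bsub>presented_group R\<^esub> word_class R w = word_class R (v @ w)"
proof -
  have "word_class R (v' @ w') = word_class R (v @ w)"
    if "v' \<in> word_class R v" "w' \<in> word_class R w" for v' w'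
  proof -
    from that have "word_eq R (v @ w) (v' @ w')"
      by (intro word_eq_append) (simp_all add: word_class_def)
    then show ?thesis by (simp add: word_class_eq_iff[symmetric])
  qed
  moreover have "v \<in> word_class R v" "w \<in> word_class R w"
    by (simp_all add: word_class_def word_eq.refl)
  ultimately have "(\<Union>v'\<in>word_class R v. \<Union>w'\<in>word_class R w. word_class R (v' @ w'))
      = word_class R (v @ w)"
    by blast
  then show ?thesis by (simp add: presented_group_def)
qed

lemma group_presented_group: "group (presented_group R)"
proof -
  let ?G = "presented_group R"
  have car: "carrier ?G = range (word_class R)" and one: "\<one>\<^bsub>?G\<^esub> = word_class R []"
    by (simp_all add: presented_group_def)
  have inverse: "\<exists>v. word_eq R (v @ w) []" for w
  proof (induction w)
    case Nil
    show ?case by (rule exI[of _ "[]"]) (simp add: word_eq.refl)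
  next
    case (Cons a w)
    obtain x b where a: "a = (x, b)" by fastforce
    from Cons obtain v where v: "word_eq R (v @ w) []" by blast
    have "word_eq R ((v @ [(x, \<not> b)]) @ a # w) (v @ w)"
      using word_eq.cancel[of R v x "\<not> b" w] by (simp add: a)
    from word_eq.trans[OF this v] show ?case by blast
  qed
  have "\<exists>v. word_class R v \<otimes>\<^bsub>?G\<^esub> word_class R w = word_class R []" for w
    unfolding presented_group_mult word_class_eq_iff by (rule inverse)
  then show ?thesis
    by (intro groupI) (auto simp: car one presented_group_mult)
qed

datatype sigma = Sigma1 | Sigma2

definition Gamma_rels ::
  "int \<Rightarrow> int \<Rightarrow> int \<Rightarrow> int \<Rightarrow> int \<Rightarrow> int \<Rightarrow> (sigma word \<times> sigma word) set" where
  "Gamma_rels p q i1 j1 i2 j2 =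
    {(gen_power Sigma1 p, []),
     (gen_power Sigma2 q, []),
     (gen_power Sigma1 1 @ gen_power Sigma2 1 @ gen_power Sigma1 1 @ gen_power Sigma2 1, []),
     (gen_power Sigma2 (-1) @ gen_power Sigma1 1, gen_power Sigma1 i1 @ gen_power Sigma2 j1),
     (gen_power Sigma2 1 @ gen_power Sigma1 (-1), gen_power Sigma1 i2 @ gen_power Sigma2 j2)}"

definition Gamma :: "int \<Rightarrow> int \<Rightarrow> int \<Rightarrow> int \<Rightarrow> int \<Rightarrow> int \<Rightarrow> sigma word set monoid" where
  "Gamma p q i1 j1 i2 j2 = presented_group (Gamma_rels p q i1 j1 i2 j2)"

definition Gamma_gen ::
  "int \<Rightarrow> int \<Rightarrow> int \<Rightarrow> int \<Rightarrow> int \<Rightarrow> int \<Rightarrow> sigma \<Rightarrow> sigma word set" where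
  "Gamma_gen p q i1 j1 i2 j2 = presented_gen (Gamma_rels p q i1 j1 i2 j2)"


section \<open>Abstract polyhedra\<close>

record 'a ranked_poset =
  elems :: "'a set"
  ord :: "('a \<times> 'a) set"
  rnk :: "'a \<Rightarrow> nat"

definition of_rank :: "'a ranked_poset \<Rightarrow> nat \<Rightarrow> 'a set" where
  "of_rank P i = {x \<in> elems P. rnk P x = i}"

definition incident :: "'a ranked_poset \<Rightarrow> 'a \<Rightarrow> 'a \<Rightarrow> bool" where
  "incident P x y \<longleftrightarrow> x \<in> elems P \<and> y \<in> elems P \<and> x \<noteq> y \<and> ((x, y) \<in> ord P \<or> (y, x) \<in> ord P)"

definition induced_connected :: "'a ranked_poset \<Rightarrow> 'a set \<Rightarrow> bool" where
  "induced_connected P S \<longleftrightarrow> S \<noteq> {} \<and>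
    (\<forall>x\<in>S. \<forall>y\<in>S. (x, y) \<in> {(u, v). u \<in> S \<and> v \<in> S \<and> incident P u v}\<^sup>*)"

definition polyhedron :: "'a ranked_poset \<Rightarrow> bool" where
  "polyhedron P \<longleftrightarrow>
    partial_order_on (elems P) (ord P) \<and>
    (\<forall>x\<in>elems P. rnk P x \<in> {0, 1, 2}) \<and>
    (\<forall>x y. (x, y) \<in> ord P \<and> x \<noteq> y \<longrightarrow> rnk P x < rnk P y) \<and>
    (\<forall>e\<in>of_rank P 1. card {v \<in> of_rank P 0. incident P v e} = 2 \<and>
                     card {f \<in> of_rank P 2. incident P e f} = 2) \<and>
    (\<forall>v\<in>of_rank P 0. \<forall>f\<in>of_rank P 2. incident P v f \<longrightarrow>
        card {e \<in> of_rank P 1. incident P v e \<and> incident P e f} = 2) \<and>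
    induced_connected P (elems P) \<and>
    (\<forall>x\<in>of_rank P 0 \<union> of_rank P 2. induced_connected P {y. incident P x y})"

type_synonym 'a flag = "'a \<times> 'a \<times> 'a"

definition flags :: "'a ranked_poset \<Rightarrow> 'a flag set" where
  "flags P = {(v, e, f). v \<in> of_rank P 0 \<and> e \<in> of_rank P 1 \<and> f \<in> of_rank P 2 \<and>
     incident P v e \<and> incident P e f \<and> incident P v f}"

fun flag_elem :: "'a flag \<Rightarrow> nat \<Rightarrow> 'a" where
  "flag_elem (v, e, f) i = (if i = 0 then v else if i = 1 then e else f)"

definition adj_flag :: "'a ranked_poset \<Rightarrow> nat \<Rightarrow> 'a flag \<Rightarrow> 'a flag" where
  "adj_flag P i \<Phi> = (THE \<Psi>. \<Psi> \<in> flags P \<and>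
     (\<forall>j\<in>{0, 1, 2}. flag_elem \<Psi> j \<noteq> flag_elem \<Phi> j \<longleftrightarrow> j = i))"

definition has_type :: "'a ranked_poset \<Rightarrow> nat \<Rightarrow> nat \<Rightarrow> bool" where
  "has_type P p q \<longleftrightarrow>
    (\<forall>f\<in>of_rank P 2. finite {e \<in> of_rank P 1. incident P e f} \<and>
                     card {e \<in> of_rank P 1. incident P e f} = p) \<and>
    (\<forall>v\<in>of_rank P 0. finite {e \<in> of_rank P 1. incident P v e} \<and>
                     card {e \<in> of_rank P 1. incident P v e} = q)"

definition tight :: "'a ranked_poset \<Rightarrow> nat \<Rightarrow> nat \<Rightarrow> bool" where
  "tight P p q \<longleftrightarrow> finite (flags P) \<and> card (flags P) = 2 * p * q"

text \<open>Automorphisms act on the right, as is customary for polytopes: in a product the left factor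
  is applied first. With this convention the distinguished generators
  \<open>\<sigma>\<^sub>1 : \<Phi> \<mapsto> (\<Phi>\<^sup>1)\<^sup>0\<close> and \<open>\<sigma>\<^sub>2 : \<Phi> \<mapsto> (\<Phi>\<^sup>2)\<^sup>1\<close> satisfy \<open>\<sigma>\<^sub>1 \<sigma>\<^sub>2 : \<Phi> \<mapsto> (\<Phi>\<^sup>2)\<^sup>0\<close>.
  Order automorphisms of a polyhedron preserve ranks automatically.\<close>

definition aut_group :: "'a ranked_poset \<Rightarrow> ('a \<Rightarrow> 'a) monoid" where
  "aut_group P =
    \<lparr>carrier = {g \<in> Bij (elems P). \<forall>x\<in>elems P. \<forall>y\<in>elems P. (g x, g y) \<in> ord P \<longleftrightarrow> (x, y) \<in> ord P},
     mult = (\<lambda>g h. compose (elems P) h g),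
     one = (\<lambda>x\<in>elems P. x)\<rparr>"

definition flag_image :: "('a \<Rightarrow> 'a) \<Rightarrow> 'a flag \<Rightarrow> 'a flag" where
  "flag_image g = map_prod g (map_prod g g)"

definition flag_transitive :: "'a ranked_poset \<Rightarrow> 'a flag set \<Rightarrow> bool" where
  "flag_transitive P C \<longleftrightarrow>
    (\<forall>\<Phi>\<in>C. \<forall>\<Psi>\<in>C. \<exists>g\<in>carrier (aut_group P). flag_image g \<Phi> = \<Psi>)"

definition chiral :: "'a ranked_poset \<Rightarrow> bool" where
  "chiral P \<longleftrightarrow> polyhedron P \<and>
    (\<exists>A B. A \<noteq> {} \<and> B \<noteq> {} \<and> A \<inter> B = {} \<and> A \<union> B = flags P \<and>
       (\<forall>\<Phi>\<in>flags P. \<forall>i\<in>{0, 1, 2}. \<Phi> \<in> A \<longleftrightarrow> adj_flag P i \<Phi> \<in> B) \<and>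
       flag_transitive P A \<and> flag_transitive P B) \<and>
    \<not> flag_transitive P (flags P)"

definition is_aut_group_of ::
  "'b monoid \<Rightarrow> 'b \<Rightarrow> 'b \<Rightarrow> 'a ranked_poset \<Rightarrow> bool" where
  "is_aut_group_of G s1 s2 P \<longleftrightarrow>
    (\<exists>\<Phi>\<in>flags P. \<exists>h\<in>iso G (aut_group P).
       flag_image (h s1) \<Phi> = adj_flag P 0 (adj_flag P 1 \<Phi>) \<and>
       flag_image (h s2) \<Phi> = adj_flag P 1 (adj_flag P 2 \<Phi>))"

definition Gamma_is_aut_group_of ::
  "int \<Rightarrow> int \<Rightarrow> int \<Rightarrow> int \<Rightarrow> int \<Rightarrow> int \<Rightarrow> 'a ranked_poset \<Rightarrow> bool" where
  "Gamma_is_aut_group_of p q i1 j1 i2 j2 P \<longleftrightarrow>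
    is_aut_group_of (Gamma p q i1 j1 i2 j2)
      (Gamma_gen p q i1 j1 i2 j2 Sigma1) (Gamma_gen p q i1 j1 i2 j2 Sigma2) P"

end

theory Submission
  imports Defs "HOL-Algebra.Multiplicative_Group" "HOL-Library.Countable_Set"
begin

text \<open>Write \<open>x = \<sigma>\<^sub>1\<close>, \<open>y = \<sigma>\<^sub>2\<close>, \<open>n = m\<^sup>\<beta>\<close> and \<open>c = k m\<^bsup>\<beta>-1\<^esup>\<close>. Modulo \<open>y\<^sup>n = (x y)\<^sup>2 = 1\<close>, both
  remaining relations say that \<open>x\<^sup>2\<close> normalises \<open>\<langle>y\<rangle>\<close>, by \<open>x\<^bsup>-2\<^esup> y x\<^sup>2 = y\<^bsup>1+c\<^esup>\<close>; hence every
  element has the form \<open>x\<^sup>i y\<^sup>j\<close>. An explicit action on pairs of residues modulo \<open>2m\<close> and \<open>n\<close> shows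
  that this form is unique, so the group has order \<open>2mn\<close> and \<open>\<langle>x\<rangle> \<inter> \<langle>y\<rangle> = 1\<close>. The right cosets of \<open>\<langle>y\<rangle>\<close>,
  \<open>\<langle>xy\<rangle>\<close> and \<open>\<langle>x\<rangle>\<close>, with incidence given by nonempty intersection, then form a polyhedron on which
  the group acts with two flag orbits. An automorphism fusing the orbits would give an endomorphism
  of the group inverting \<open>x\<close> and \<open>y\<close>; applied to the fourth relation and compared with the fifth it
  yields \<open>y\<^bsup>2c\<^esup> = 1\<close>, which is impossible since \<open>m\<close> does not divide \<open>2k\<close>.\<close>

section \<open>The coset polyhedron of a rotation group\<close>

locale rotation_group = group G for G :: "'a monoid" (structure) +
  fixes x y :: 'a
  assumes finite_carrier: "finite (carrier G)"
    and x_closed [simp]: "x \<in> carrier G" and y_closed [simp]: "y \<in> carrier G"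
    and generated: "generate G {x, y} = carrier G"
    and xy_involution: "x \<otimes> y \<otimes> (x \<otimes> y) = \<one>"
    and generate_inter: "generate G {x} \<inter> generate G {y} = {\<one>}"
    and x_not_one: "x \<noteq> \<one>" and y_not_one: "y \<noteq> \<one>"
begin

section \<open>Cosets of the three stabilisers\<close>

lemma y_x_y: "y \<otimes> (x \<otimes> y) = inv x"
proof (rule inv_equality[symmetric])
  have "(y \<otimes> (x \<otimes> y)) \<otimes> x = inv x \<otimes> (x \<otimes> y \<otimes> (x \<otimes> y)) \<otimes> x"
    by (simp add: m_assoc[symmetric])
  then show "(y \<otimes> (x \<otimes> y)) \<otimes> x = \<one>" by (simp add: xy_involution)
qed simp_all

lemma x_y_x: "x \<otimes> (y \<otimes> x) = inv y"
  by (rule inv_equality[symmetric]) (use xy_involution in \<open>simp_all add: m_assoc\<close>)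

text \<open>Cosets are subsets of a finite carrier, so numbering \<open>Pow (carrier G)\<close>
  turns them into natural numbers. The polyhedron thus lives on \<open>nat\<close>, whatever the
  type of \<open>G\<close>.\<close>

definition coset_label :: "'a \<Rightarrow> 'a \<Rightarrow> nat" where
  "coset_label s g = to_nat_on (Pow (carrier G)) (generate G {s} #> g)"

text \<open>Vertices, edges and faces are the right cosets of the stabilisers \<open>\<langle>y\<rangle>\<close>, \<open>\<langle>xy\<rangle>\<close>,
  \<open>\<langle>x\<rangle>\<close>, coded so that the rank is the residue modulo 3.\<close>

definition V :: "'a \<Rightarrow> nat" where "V g = 3 * coset_label y g"
definition E :: "'a \<Rightarrow> nat" where "E g = 3 * coset_label (x \<otimes> y) g + 1"
definition F :: "'a \<Rightarrow> nat" where "F g = 3 * coset_label x g + 2"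

lemma coset_label_eq_iff:
  assumes "s \<in> carrier G" "a \<in> carrier G" "b \<in> carrier G"
  shows "coset_label s a = coset_label s b \<longleftrightarrow> (\<exists>h\<in>generate G {s}. a = h \<otimes> b)"
proof -
  interpret H: subgroup "generate G {s}" G
    using assms(1) by (intro generate_is_subgroup) simp
  have "generate G {s} #> a \<in> Pow (carrier G)" "generate G {s} #> b \<in> Pow (carrier G)"
    using assms by (simp_all add: r_coset_subset_G H.subset)
  then have "coset_label s a = coset_label s b \<longleftrightarrow> generate G {s} #> a = generate G {s} #> b"
    unfolding coset_label_def using finite_carrier
    by (intro inj_on_eq_iff[OF inj_on_to_nat_on]) (simp_all add: countable_finite)
  also have "\<dots> \<longleftrightarrow> a \<in> generate G {s} #> b"
    using repr_independence[OF _ assms(3) H.subgroup_axioms] rcos_self[OF assms(2) H.subgroup_axioms]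
    by auto
  finally show ?thesis by (auto simp: r_coset_def)
qed

text \<open>Since \<open>x y\<close> is its own inverse, nothing new arises from products. An edge
  \<open>E a\<close> is therefore represented by \<open>a\<close> and \<open>x y a\<close> alone,
  which is the source of its two endpoints and two faces.\<close>

lemma generate_involution: "generate G {x \<otimes> y} = {\<one>, x \<otimes> y}"
proof
  show "generate G {x \<otimes> y} \<subseteq> {\<one>, x \<otimes> y}"
  proof
    fix h assume "h \<in> generate G {x \<otimes> y}"
    then show "h \<in> {\<one>, x \<otimes> y}"
    proof induction
      case (inv h)
      then show ?case using xy_involution inv_equality by auto
    next
      case (eng h1 h2)
      then show ?case using xy_involution by auto
    qed auto
  qed
qed (auto intro: generate.intros)

lemma V_eq_iff: "a \<in> carrier G \<Longrightarrow> b \<in> carrier G \<Longrightarrow> V a = V b \<longleftrightarrow> (\<exists>h\<in>generate G {y}. a = h \<otimes> b)"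
  by (simp add: V_def coset_label_eq_iff)

lemma F_eq_iff: "a \<in> carrier G \<Longrightarrow> b \<in> carrier G \<Longrightarrow> F a = F b \<longleftrightarrow> (\<exists>h\<in>generate G {x}. a = h \<otimes> b)"
  by (simp add: F_def coset_label_eq_iff)

lemma E_eq_iff: "a \<in> carrier G \<Longrightarrow> b \<in> carrier G \<Longrightarrow> E a = E b \<longleftrightarrow> a = b \<or> a = x \<otimes> y \<otimes> b"
  by (simp add: E_def coset_label_eq_iff generate_involution)

lemma VEF_mod [simp]: "V a mod 3 = 0" "E a mod 3 = 1" "F a mod 3 = 2"
  unfolding V_def E_def F_def by presburger+

lemma VEF_dvd [simp]: "3 dvd V a" "\<not> 3 dvd E a" "\<not> 3 dvd F a"
  unfolding V_def E_def F_def by presburger+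

lemma VEF_distinct [simp]: "V a \<noteq> E b" "E b \<noteq> V a" "V a \<noteq> F b" "F b \<noteq> V a" "E a \<noteq> F b" "F b \<noteq> E a"
  unfolding V_def E_def F_def by presburger+

lemma V_translate [simp]:
  assumes "a \<in> carrier G"
  shows "V (y \<otimes> a) = V a" "V (inv y \<otimes> a) = V a"
  using assms generate.incl[of y "{y}" G] generate.inv[of y "{y}" G] by (auto simp: V_eq_iff)

lemma F_translate [simp]:
  assumes "a \<in> carrier G"
  shows "F (x \<otimes> a) = F a" "F (inv x \<otimes> a) = F a"
  using assms generate.incl[of x "{x}" G] generate.inv[of x "{x}" G] by (auto simp: F_eq_iff)

lemma E_translate [simp]: "a \<in> carrier G \<Longrightarrow> E (x \<otimes> y \<otimes> a) = E a"
  by (auto simp: E_eq_iff)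

lemma F_flip [simp]: "a \<in> carrier G \<Longrightarrow> F (x \<otimes> y \<otimes> a) = F (y \<otimes> a)"
  by (simp add: m_assoc)

text \<open>As \<open>x y x = inv y\<close>, left multiplication by \<open>x y\<close> carries
  \<open>x a\<close> to \<open>inv y a\<close> within one edge coset. One name shows that this edge
  lies on the face \<open>F a\<close>, the other that it contains the vertex
  \<open>V a\<close>.\<close>

lemma E_rotate: "a \<in> carrier G \<Longrightarrow> E (x \<otimes> a) = E (inv y \<otimes> a)"
proof -
  assume a: "a \<in> carrier G"
  have "x \<otimes> y \<otimes> (x \<otimes> a) = x \<otimes> (y \<otimes> x) \<otimes> a" using a by (simp add: m_assoc)
  with E_translate[of "x \<otimes> a"] a show ?thesis by (simp add: x_y_x)
qed

lemma generate_subset: "generate G {x} \<subseteq> carrier G" "generate G {y} \<subseteq> carrier G"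
  using generate_incl[of "{x}"] generate_incl[of "{y}"] by auto

text \<open>Otherwise, cancelling one factor would put the other generator into the trivial
  intersection of \<open><x>\<close> and \<open><y>\<close>. This keeps the two endpoints, and the
  two faces, of an edge apart.\<close>

lemma xy_notin: "x \<otimes> y \<notin> generate G {x}" "x \<otimes> y \<notin> generate G {y}"
proof -
  interpret X: subgroup "generate G {x}" G by (intro generate_is_subgroup) simp
  interpret Y: subgroup "generate G {y}" G by (intro generate_is_subgroup) simp
  have x: "x \<in> generate G {x}" and y: "y \<in> generate G {y}" by (auto intro: generate.incl)
  show "x \<otimes> y \<notin> generate G {x}"
  proof
    assume "x \<otimes> y \<in> generate G {x}"
    then have "inv x \<otimes> (x \<otimes> y) \<in> generate G {x}" using x by blast
    then have "y \<in> generate G {x}" by (simp add: m_assoc[symmetric])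
    then show False using y generate_inter y_not_one by blast
  qed
  show "x \<otimes> y \<notin> generate G {y}"
  proof
    assume "x \<otimes> y \<in> generate G {y}"
    then have "x \<otimes> y \<otimes> inv y \<in> generate G {y}" using y by blast
    then have "x \<in> generate G {y}" by (simp add: m_assoc)
    then show False using x generate_inter x_not_one by blast
  qed
qed

lemma V_flip_neq [simp]:
  assumes "a \<in> carrier G" shows "V (x \<otimes> y \<otimes> a) \<noteq> V a" "V a \<noteq> V (x \<otimes> y \<otimes> a)"
proof -
  show "V (x \<otimes> y \<otimes> a) \<noteq> V a"
  proof
    assume "V (x \<otimes> y \<otimes> a) = V a"
    then obtain h where "h \<in> generate G {y}" "x \<otimes> y \<otimes> a = h \<otimes> a" using assms by (auto simp: V_eq_iff)
    then show False using assms xy_notin(2) generate_subset(2)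
      by (auto simp: subset_iff)
  qed
  then show "V a \<noteq> V (x \<otimes> y \<otimes> a)" by simp
qed

lemma F_flip_neq [simp]:
  assumes "a \<in> carrier G" shows "F (y \<otimes> a) \<noteq> F a" "F a \<noteq> F (y \<otimes> a)"
proof -
  show "F (y \<otimes> a) \<noteq> F a"
  proof
    assume "F (y \<otimes> a) = F a"
    then have "F (x \<otimes> y \<otimes> a) = F a" using assms by simp
    then obtain h where "h \<in> generate G {x}" "x \<otimes> y \<otimes> a = h \<otimes> a" 
      using F_eq_iff[of "x \<otimes> y \<otimes> a" a] assms by auto
    then show False using assms xy_notin(1) generate_subset(1)
      by (auto simp: subset_iff)
  qed
  then show "F a \<noteq> F (y \<otimes> a)" by simp
qed

text \<open>Equal edges leave only \<open>a = b\<close> or \<open>a = x y b\<close>, and in the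
  second case the vertices differ. Together with the next two lemmas: any two of \<open>V a\<close>,
  \<open>E a\<close>, \<open>F a\<close> determine \<open>a\<close>.\<close>

lemma VE_inj: "\<lbrakk>a \<in> carrier G; b \<in> carrier G; V a = V b; E a = E b\<rbrakk> \<Longrightarrow> a = b"
  by (auto simp: E_eq_iff)

lemma EF_inj: "\<lbrakk>a \<in> carrier G; b \<in> carrier G; F a = F b; E a = E b\<rbrakk> \<Longrightarrow> a = b"
  by (auto simp: E_eq_iff)

text \<open>The quotient of the two elements lies in both \<open><x>\<close> and \<open><y>\<close>,
  which meet trivially.\<close>

lemma VF_inj:
  assumes "a \<in> carrier G" "b \<in> carrier G" "V a = V b" "F a = F b"
  shows "a = b"
proof -
  obtain h where h: "h \<in> generate G {y}" "a = h \<otimes> b" using assms by (auto simp: V_eq_iff)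
  obtain h' where h': "h' \<in> generate G {x}" "a = h' \<otimes> b" using assms by (auto simp: F_eq_iff)
  have "h = h'" using h h' assms(2) generate_subset by (auto simp: subset_iff)
  then have "h = \<one>" using h h' generate_inter by blast
  then show ?thesis using h assms(2) by simp
qed

lemma E_x_neq [simp]:
  assumes "a \<in> carrier G" shows "E (x \<otimes> a) \<noteq> E a" "E a \<noteq> E (x \<otimes> a)"
  using EF_inj[of "x \<otimes> a" a] assms x_not_one by auto

text \<open>Right multiplication commutes with left multiplication by the stabiliser, hence permutes
  right cosets. This makes \<open>translation\<close> below independent of representatives.\<close>

lemma right_translate:
  assumes "a \<in> carrier G" "b \<in> carrier G" "g \<in> carrier G"
  shows "V (a \<otimes> g) = V (b \<otimes> g) \<longleftrightarrow> V a = V b"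
    and "E (a \<otimes> g) = E (b \<otimes> g) \<longleftrightarrow> E a = E b"
    and "F (a \<otimes> g) = F (b \<otimes> g) \<longleftrightarrow> F a = F b"
proof -
  have *: "a \<otimes> g = h \<otimes> (b \<otimes> g) \<longleftrightarrow> a = h \<otimes> b" if "h \<in> carrier G" for h
    using that assms by (simp add: m_assoc[symmetric])
  show "V (a \<otimes> g) = V (b \<otimes> g) \<longleftrightarrow> V a = V b"
    unfolding V_eq_iff[OF m_closed m_closed, OF assms(1,3,2,3)] V_eq_iff[OF assms(1,2)]
    using generate_subset(2) by (intro bex_cong refl *) auto
  show "F (a \<otimes> g) = F (b \<otimes> g) \<longleftrightarrow> F a = F b"
    unfolding F_eq_iff[OF m_closed m_closed, OF assms(1,3,2,3)] F_eq_iff[OF assms(1,2)]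
    using generate_subset(1) by (intro bex_cong refl *) auto
  show "E (a \<otimes> g) = E (b \<otimes> g) \<longleftrightarrow> E a = E b"
    unfolding E_eq_iff[OF m_closed m_closed, OF assms(1,3,2,3)] E_eq_iff[OF assms(1,2)]
    using assms *[of "x \<otimes> y"] by simp
qed

section \<open>The incidence order\<close>

definition P :: "nat ranked_poset" where
  "P = \<lparr>elems = V ` carrier G \<union> E ` carrier G \<union> F ` carrier G,
     ord = Id_on (V ` carrier G \<union> E ` carrier G \<union> F ` carrier G) \<union>
       (\<lambda>g. (V g, E g)) ` carrier G \<union> (\<lambda>g. (E g, F g)) ` carrier G \<union> (\<lambda>g. (V g, F g)) ` carrier G,
     rnk = (\<lambda>n. n mod 3)\<rparr>"

lemma elems_P: "elems P = V ` carrier G \<union> E ` carrier G \<union> F ` carrier G"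
  by (simp add: P_def)

lemma elems_P_I [simp]:
  "g \<in> carrier G \<Longrightarrow> V g \<in> elems P" "g \<in> carrier G \<Longrightarrow> E g \<in> elems P" "g \<in> carrier G \<Longrightarrow> F g \<in> elems P"
  by (simp_all add: elems_P)

lemma elems_P_cases:
  assumes "n \<in> elems P"
  obtains g where "g \<in> carrier G" "n = V g" | g where "g \<in> carrier G" "n = E g" | g where "g \<in> carrier G" "n = F g"
  using assms by (auto simp: elems_P)

lemma rnk_P [simp]: "rnk P n = n mod 3"
  by (simp add: P_def)

lemma of_rank_P:
  "of_rank P 0 = V ` carrier G" "of_rank P 1 = E ` carrier G" "of_rank P (Suc 0) = E ` carrier G"
  "of_rank P 2 = F ` carrier G"
  by (auto simp: of_rank_def elems_P)

lemma ord_P_iff: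
  "(u, v) \<in> ranked_poset.ord P \<longleftrightarrow> u = v \<and> u \<in> elems P \<or>
     (\<exists>g\<in>carrier G. u = V g \<and> v = E g \<or> u = E g \<and> v = F g \<or> u = V g \<and> v = F g)"
  unfolding elems_P by (auto simp: P_def Id_on_def)

lemma incident_VE: "incident P (V a) (E b) \<longleftrightarrow> (\<exists>g\<in>carrier G. V a = V g \<and> E b = E g)"
  unfolding incident_def ord_P_iff by auto

lemma incident_VF: "incident P (V a) (F b) \<longleftrightarrow> (\<exists>g\<in>carrier G. V a = V g \<and> F b = F g)"
  unfolding incident_def ord_P_iff by auto

lemma incident_EF: "incident P (E a) (F b) \<longleftrightarrow> (\<exists>g\<in>carrier G. E a = E g \<and> F b = F g)"
  unfolding incident_def ord_P_iff by auto

lemma incident_same_rank [simp]: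
  "\<not> incident P (V a) (V b)" "\<not> incident P (E a) (E b)" "\<not> incident P (F a) (F b)"
  unfolding incident_def ord_P_iff by auto

lemma incident_sym: "incident P a b \<longleftrightarrow> incident P b a"
  unfolding incident_def by auto

lemma flag_incident [simp]:
  assumes "g \<in> carrier G"
  shows "incident P (V g) (E g)" "incident P (V g) (F g)" "incident P (E g) (F g)"
    "incident P (E g) (V g)" "incident P (F g) (V g)" "incident P (F g) (E g)"
  using assms incident_VE incident_VF incident_EF incident_sym by blast+

lemma VE_pair_iff:
  assumes "a \<in> carrier G" "b \<in> carrier G"
  shows "incident P (V a) (E b) \<longleftrightarrow> V a = V b \<or> V a = V (x \<otimes> y \<otimes> b)"
proof
  assume "incident P (V a) (E b)"
  then obtain g where "g \<in> carrier G" "V a = V g" "E g = E b" by (auto simp: incident_VE)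
  then show "V a = V b \<or> V a = V (x \<otimes> y \<otimes> b)" using assms by (auto simp: E_eq_iff)
next
  assume "V a = V b \<or> V a = V (x \<otimes> y \<otimes> b)"
  then show "incident P (V a) (E b)"
    using flag_incident(1)[of b] flag_incident(1)[of "x \<otimes> y \<otimes> b"] assms by auto
qed

lemma EF_pair_iff:
  assumes "a \<in> carrier G" "b \<in> carrier G"
  shows "incident P (E a) (F b) \<longleftrightarrow> F b = F a \<or> F b = F (y \<otimes> a)"
proof
  assume "incident P (E a) (F b)"
  then obtain g where "g \<in> carrier G" "F b = F g" "E g = E a" by (auto simp: incident_EF)
  then show "F b = F a \<or> F b = F (y \<otimes> a)" using assms by (auto simp: E_eq_iff)
next
  assume "F b = F a \<or> F b = F (y \<otimes> a)"
  then show "incident P (E a) (F b)"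
    using flag_incident(3)[of a] flag_incident(3)[of "x \<otimes> y \<otimes> a"] assms by auto
qed

text \<open>This is transitivity along a chain vertex, edge, face. If the two representatives of the
  edge differ, then \<open>b = x y a\<close>, so \<open>F b = F (y a)\<close> while
  \<open>V a = V (y a)\<close>, and \<open>y a\<close> represents both.\<close>

lemma VF_pair:
  assumes "a \<in> carrier G" "b \<in> carrier G" "E a = E b"
  shows "incident P (V a) (F b)"
proof -
  from assms(3) consider "b = a" | "b = x \<otimes> y \<otimes> a"
    using E_eq_iff[of b a] assms by auto
  then show ?thesis
  proof cases
    case 2
    then show ?thesis using flag_incident(2)[of "y \<otimes> a"] assms by simp
  qed (use assms in simp)
qed

section \<open>Order axioms, connectedness and the diamond condition\<close>

lemma partial_order_P: "partial_order_on (elems P) (ranked_poset.ord P)"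
proof -
  have strict: "u mod 3 < v mod 3" if "(u, v) \<in> ranked_poset.ord P" "u \<noteq> v" for u v
    using that by (auto simp: ord_P_iff)
  have "ranked_poset.ord P \<subseteq> elems P \<times> elems P"
    by (auto simp: ord_P_iff)
  moreover have "refl_on (elems P) (ranked_poset.ord P)"
    by (auto simp: refl_on_def ord_P_iff)
  moreover have "trans (ranked_poset.ord P)"
  proof (rule transI)
    fix u v w assume uv: "(u, v) \<in> ranked_poset.ord P" and vw: "(v, w) \<in> ranked_poset.ord P"
    show "(u, w) \<in> ranked_poset.ord P"
    proof (cases "u = v \<or> v = w")
      case True
      then show ?thesis using uv vw by auto
    next
      case False
      \<comment> \<open>Two proper steps can only run from a vertex through an edge to a
        face.\<close>
      then obtain a b where "a \<in> carrier G" "b \<in> carrier G" "u = V a" "w = F b" "E a = E b"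
        using uv vw unfolding ord_P_iff by auto
      then show ?thesis using VF_pair[of a b] unfolding incident_def ord_P_iff by auto
    qed
  qed
  moreover have "antisym (ranked_poset.ord P)"
    by (rule antisymI) (metis strict less_asym)
  ultimately show ?thesis by (simp add: partial_order_on_def preorder_on_def)
qed

text \<open>Paths for single generators are concatenated along a word for \<open>h\<close>, and
  reversed by symmetry of \<open>R\<close> where an inverse generator occurs. The set
  \<open>D\<close> will be the whole carrier for the polyhedron, and one coset for a vertex figure
  or a face.\<close>

lemma generate_path:
  assumes "S \<subseteq> carrier G" "D \<subseteq> carrier G" "sym R"
    and "\<And>s g. s \<in> S \<Longrightarrow> g \<in> D \<Longrightarrow> s \<otimes> g \<in> D \<and> inv s \<otimes> g \<in> D"
    and "\<And>s g. s \<in> S \<Longrightarrow> g \<in> D \<Longrightarrow> (\<phi> g, \<phi> (s \<otimes> g)) \<in> R\<^sup>*"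
    and "h \<in> generate G S" "g \<in> D"
  shows "h \<otimes> g \<in> D \<and> (\<phi> g, \<phi> (h \<otimes> g)) \<in> R\<^sup>*"
  using assms(6,7)
proof (induction arbitrary: g)
  case one
  then show ?case using assms(2) by auto
next
  case (incl h)
  then show ?case using assms(4,5) by blast
next
  case (inv h)
  then have "h \<in> carrier G" "g \<in> carrier G" using assms(1,2) by auto
  then have "h \<otimes> (inv h \<otimes> g) = g" by (simp add: m_assoc[symmetric])
  with assms(5)[of h "inv h \<otimes> g"] assms(4) inv have "(\<phi> (inv h \<otimes> g), \<phi> g) \<in> R\<^sup>*" by auto
  then show ?case using assms(3,4) inv by (meson sym_rtrancl symD)
next
  case (eng h1 h2)
  then have "h1 \<otimes> h2 \<otimes> g = h1 \<otimes> (h2 \<otimes> g)"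
    using generate_in_carrier[OF assms(1)] assms(2) by (auto intro!: m_assoc)
  with eng.IH(1)[of "h2 \<otimes> g"] eng.IH(2)[of g] eng.prems show ?case by (metis rtrancl_trans)
qed

abbreviation nbrs :: "nat \<Rightarrow> nat set" where
  "nbrs u \<equiv> {v. incident P u v}"

abbreviation edge_rel :: "nat set \<Rightarrow> (nat \<times> nat) set" where
  "edge_rel S \<equiv> {(u, v). u \<in> S \<and> v \<in> S \<and> incident P u v}"

lemma sym_edge_rel: "sym (edge_rel S)"
  by (auto simp: sym_def incident_def)

lemma induced_connectedI:
  assumes "c \<in> S" "\<And>u. u \<in> S \<Longrightarrow> (c, u) \<in> (edge_rel S)\<^sup>*"
  shows "induced_connected P S"
  unfolding induced_connected_def
  using assms sym_rtrancl[OF sym_edge_rel[of S]] by (auto intro: rtrancl_trans dest: symD)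

lemma connected_P: "induced_connected P (elems P)"
proof -
  let ?R = "edge_rel (elems P)"
  \<comment> \<open>\<open>V\<close> is constant along \<open>y\<close>; along \<open>x\<close> the
    common face \<open>F g = F (x g)\<close> joins the two vertices.\<close>
  have step: "(V g, V (x \<otimes> g)) \<in> ?R\<^sup>*" if g: "g \<in> carrier G" for g
  proof -
    have "(V g, F g) \<in> ?R" "(F g, V (x \<otimes> g)) \<in> ?R"
      using g flag_incident(5)[of "x \<otimes> g"] by auto
    then show ?thesis by (meson converse_rtrancl_into_rtrancl r_into_rtrancl)
  qed
  have V: "(V \<one>, V g) \<in> ?R\<^sup>*" if "g \<in> carrier G" for g
  proof -
    have "(V h, V (s \<otimes> h)) \<in> ?R\<^sup>*" if "s \<in> {x, y}" "h \<in> carrier G" for s h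
      using that step by auto
    moreover have "s \<otimes> h \<in> carrier G \<and> inv s \<otimes> h \<in> carrier G" if "s \<in> {x, y}" "h \<in> carrier G" for s h
      using that by auto
    ultimately show ?thesis
      using generate_path[OF _ _ sym_edge_rel, of "{x, y}" "carrier G" V "elems P" g \<one>] that
      by (auto simp: generated)
  qed
  have E: "(V \<one>, E g) \<in> ?R\<^sup>*" if "g \<in> carrier G" for g
    by (rule rtrancl_into_rtrancl[OF V[OF that]]) (use that in auto)
  have F: "(V \<one>, F g) \<in> ?R\<^sup>*" if "g \<in> carrier G" for g
    by (rule rtrancl_into_rtrancl[OF V[OF that]]) (use that in auto)
  show ?thesis
  proof (rule induced_connectedI[of "V \<one>"])
    fix u assume "u \<in> elems P"
    then show "(V \<one>, u) \<in> ?R\<^sup>*" using V E F by (cases rule: elems_P_cases) blast+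
  qed simp
qed

lemma connected_vertex_figure:
  assumes a: "a \<in> carrier G"
  shows "induced_connected P (nbrs (V a))"
proof -
  let ?S = "nbrs (V a)" and ?D = "{g \<in> carrier G. V g = V a}"
  let ?R = "edge_rel ?S"
  have in_S: "E g \<in> ?S" "F g \<in> ?S" if "g \<in> ?D" for g
    using that flag_incident(1,2)[of g] by auto
  \<comment> \<open>\<open>F (y g)\<close> is the second face on the edge \<open>E g\<close>, and it
    is also a face on \<open>E (y g)\<close>.\<close>
  have step: "(E g, E (y \<otimes> g)) \<in> ?R\<^sup>*" if g: "g \<in> ?D" for g
  proof -
    have "(E g, F (y \<otimes> g)) \<in> ?R" "(F (y \<otimes> g), E (y \<otimes> g)) \<in> ?R"
      using g in_S[of g] in_S[of "y \<otimes> g"] by (auto simp: EF_pair_iff)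
    then show ?thesis by (meson converse_rtrancl_into_rtrancl r_into_rtrancl)
  qed
  have E: "(E a, E g) \<in> ?R\<^sup>*" if "g \<in> ?D" for g
  proof -
    from that obtain h where "h \<in> generate G {y}" "g = h \<otimes> a" using a by (auto simp: V_eq_iff)
    then show ?thesis
      using generate_path[of "{y}" ?D ?R E h a] sym_edge_rel[of ?S] step a by auto
  qed
  have EF: "(E a, F g) \<in> ?R\<^sup>*" if "g \<in> ?D" for g
    by (rule rtrancl_into_rtrancl[OF E[OF that]]) (use that in_S[OF that] in auto)
  show ?thesis
  proof (rule induced_connectedI[of "E a"])
    fix u assume u: "u \<in> ?S"
    then have "u \<in> elems P" by (simp add: incident_def)
    then obtain g where "g \<in> ?D" "u = E g \<or> u = F g"
      using u by (cases rule: elems_P_cases) (auto simp: incident_VE incident_VF)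
    then show "(E a, u) \<in> ?R\<^sup>*" using E EF by blast
  qed (use a in simp)
qed

lemma connected_face:
  assumes a: "a \<in> carrier G"
  shows "induced_connected P (nbrs (F a))"
proof -
  let ?S = "nbrs (F a)" and ?D = "{g \<in> carrier G. F g = F a}"
  let ?R = "edge_rel ?S"
  have in_S: "E g \<in> ?S" "V g \<in> ?S" if "g \<in> ?D" for g
    using that flag_incident(5,6)[of g] by auto
  \<comment> \<open>\<open>E (x g) = E (inv y g)\<close> contains the vertex
    \<open>V (inv y g) = V g\<close>, so the two edges meet in \<open>V g\<close>.\<close>
  have step: "(E g, E (x \<otimes> g)) \<in> ?R\<^sup>*" if g: "g \<in> ?D" for g
  proof -
    have "(E g, V g) \<in> ?R" "(V g, E (x \<otimes> g)) \<in> ?R"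
      using g in_S[of g] in_S[of "x \<otimes> g"] flag_incident(1)[of "inv y \<otimes> g"]
      by (auto simp: E_rotate)
    then show ?thesis by (meson converse_rtrancl_into_rtrancl r_into_rtrancl)
  qed
  have E: "(E a, E g) \<in> ?R\<^sup>*" if "g \<in> ?D" for g
  proof -
    from that obtain h where "h \<in> generate G {x}" "g = h \<otimes> a" using a by (auto simp: F_eq_iff)
    then show ?thesis
      using generate_path[of "{x}" ?D ?R E h a] sym_edge_rel[of ?S] step a by auto
  qed
  have EV: "(E a, V g) \<in> ?R\<^sup>*" if "g \<in> ?D" for g
    by (rule rtrancl_into_rtrancl[OF E[OF that]]) (use that in_S[OF that] in auto)
  show ?thesis
  proof (rule induced_connectedI[of "E a"])
    fix u assume u: "u \<in> ?S"
    then have "u \<in> elems P" by (simp add: incident_def)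
    then obtain g where "g \<in> ?D" "u = E g \<or> u = V g"
      using u by (cases rule: elems_P_cases)
        (auto simp: incident_sym[of "F a"] incident_EF incident_VF)
    then show "(E a, u) \<in> ?R\<^sup>*" using E EV by blast
  qed (use a in simp)
qed

text \<open>Seen from the vertex, an edge is \<open>E g\<close> with \<open>V g = V a\<close>, and
  its faces are \<open>F g\<close> and \<open>F (y g)\<close>. Matching \<open>F a\<close> forces
  \<open>g = a\<close> or \<open>g = inv y a\<close>, and
  \<open>E (inv y a) = E (x a)\<close>.\<close>

lemma edges_between:
  assumes a: "a \<in> carrier G"
  shows "{e \<in> of_rank P 1. incident P (V a) e \<and> incident P e (F a)} = {E a, E (x \<otimes> a)}"
proof (intro equalityI subsetI)
  fix e assume "e \<in> {e \<in> of_rank P 1. incident P (V a) e \<and> incident P e (F a)}"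
  then obtain g where g: "g \<in> carrier G" "e = E g" "V g = V a" "incident P (E g) (F a)"
    by (auto simp: of_rank_P incident_VE)
  then consider "F g = F a" | "F (y \<otimes> g) = F a" using a by (auto simp: EF_pair_iff)
  then show "e \<in> {E a, E (x \<otimes> a)}"
  proof cases
    case 1
    then show ?thesis using VF_inj[OF g(1) a] g by simp
  next
    case 2
    then have "y \<otimes> g = a" using VF_inj[of "y \<otimes> g" a] g a by simp
    then have "g = inv y \<otimes> a" using g(1) by (auto simp: m_assoc[symmetric])
    then show ?thesis using g E_rotate[OF a] by simp
  qed
next
  fix e assume "e \<in> {E a, E (x \<otimes> a)}"
  then show "e \<in> {e \<in> of_rank P 1. incident P (V a) e \<and> incident P e (F a)}"
    using a flag_incident(1)[of "inv y \<otimes> a"] flag_incident(3)[of "x \<otimes> a"]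
    by (auto simp: of_rank_P E_rotate)
qed

theorem polyhedron_P: "polyhedron P"
  unfolding polyhedron_def
proof (intro conjI ballI allI impI)
  show "partial_order_on (elems P) (ranked_poset.ord P)" by (rule partial_order_P)
  show "induced_connected P (elems P)" by (rule connected_P)
next
  fix u assume "u \<in> elems P"
  then show "rnk P u \<in> {0, 1, 2}" by (auto elim: elems_P_cases)
next
  fix u v assume "(u, v) \<in> ranked_poset.ord P \<and> u \<noteq> v"
  then show "rnk P u < rnk P v" by (auto simp: ord_P_iff)
next
  fix e assume "e \<in> of_rank P 1"
  then obtain g where g: "g \<in> carrier G" "e = E g" by (auto simp: of_rank_P)
  have "{v \<in> of_rank P 0. incident P v e} = {V g, V (x \<otimes> y \<otimes> g)}"
    using g by (auto simp: of_rank_P VE_pair_iff)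
  then show "card {v \<in> of_rank P 0. incident P v e} = 2" using g by simp
  have "{f \<in> of_rank P 2. incident P e f} = {F g, F (y \<otimes> g)}"
    using g by (auto simp: of_rank_P EF_pair_iff)
  then show "card {f \<in> of_rank P 2. incident P e f} = 2" using g by simp
next
  fix v f assume "v \<in> of_rank P 0" "f \<in> of_rank P 2" "incident P v f"
  then obtain g where g: "g \<in> carrier G" "v = V g" "f = F g"
    by (auto simp: of_rank_P incident_VF)
  then show "card {e \<in> of_rank P 1. incident P v e \<and> incident P e f} = 2"
    using edges_between[of g] by simp
next
  fix u assume "u \<in> of_rank P 0 \<union> of_rank P 2"
  then show "induced_connected P (nbrs u)"
    by (auto simp: of_rank_P connected_vertex_figure connected_face)
qed

section \<open>Flags and their adjacency\<close>

text \<open>\<open>W g\<close> is the image of the base flag under \<open>g\<close>, and \<open>B g\<close> is the flag 2-adjacent to it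
  (its face is that of \<open>x y g\<close>, which equals that of \<open>y g\<close>).\<close>

definition W :: "'a \<Rightarrow> nat flag" where "W g = (V g, E g, F g)"
definition B :: "'a \<Rightarrow> nat flag" where "B g = (V g, E g, F (y \<otimes> g))"

lemma W_eq_iff [simp]: "a \<in> carrier G \<Longrightarrow> b \<in> carrier G \<Longrightarrow> W a = W b \<longleftrightarrow> a = b"
  unfolding W_def using VE_inj[of a b] by auto

lemma B_eq_iff [simp]: "a \<in> carrier G \<Longrightarrow> b \<in> carrier G \<Longrightarrow> B a = B b \<longleftrightarrow> a = b"
  unfolding B_def using VE_inj[of a b] by auto

lemma W_neq_B [simp]:
  assumes "a \<in> carrier G" "b \<in> carrier G" shows "W a \<noteq> B b" "B b \<noteq> W a"
proof -
  show "W a \<noteq> B b"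
  proof
    assume *: "W a = B b"
    then have "a = b" using VE_inj[of a b] assms unfolding W_def B_def by auto
    with * show False using assms unfolding W_def B_def by simp
  qed
  then show "B b \<noteq> W a" by simp
qed

text \<open>A common representative of vertex and edge fixes the group element; the face is then
  either of the two on that edge. This gives one \<open>W\<close> flag and one \<open>B\<close> flag
  per group element.\<close>

lemma flags_P: "flags P = W ` carrier G \<union> B ` carrier G"
proof (intro equalityI subsetI)
  fix \<Phi> assume "\<Phi> \<in> flags P"
  then obtain a' b c where \<Phi>: "\<Phi> = (V a', E b, F c)" and c: "c \<in> carrier G"
    and inc: "incident P (V a') (E b)" "incident P (E b) (F c)"
    unfolding flags_def of_rank_P by blast
  from inc(1) obtain a where a: "a \<in> carrier G" "V a' = V a" "E b = E a"
    unfolding incident_VE by blast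
  with inc(2) c have "F c = F a \<or> F c = F (y \<otimes> a)" using EF_pair_iff[of a c] by simp
  then show "\<Phi> \<in> W ` carrier G \<union> B ` carrier G" using a \<Phi> by (auto simp: W_def B_def)
next
  fix \<Phi> assume "\<Phi> \<in> W ` carrier G \<union> B ` carrier G"
  then obtain g where g: "g \<in> carrier G" "\<Phi> = W g \<or> \<Phi> = B g" by auto
  then show "\<Phi> \<in> flags P"
    using flag_incident(1-3)[of g] flag_incident(2)[of "y \<otimes> g"] EF_pair_iff[of g "y \<otimes> g"]
    unfolding flags_def W_def B_def of_rank_P by fastforce
qed

lemma W_flag [simp]: "g \<in> carrier G \<Longrightarrow> W g \<in> flags P"
  and B_flag [simp]: "g \<in> carrier G \<Longrightarrow> B g \<in> flags P"
  by (auto simp: flags_P)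

lemma flags_cases:
  assumes "\<Phi> \<in> flags P"
  obtains g where "g \<in> carrier G" "\<Phi> = W g" | g where "g \<in> carrier G" "\<Phi> = B g"
  using assms by (auto simp: flags_P)

lemma card_flags: "finite (flags P)" "card (flags P) = 2 * card (carrier G)"
proof -
  have "inj_on W (carrier G)" "inj_on B (carrier G)" by (auto intro!: inj_onI)
  moreover have "W ` carrier G \<inter> B ` carrier G = {}" by auto
  ultimately show "card (flags P) = 2 * card (carrier G)"
    using finite_carrier by (simp add: flags_P card_Un_disjoint card_image)
  show "finite (flags P)" using finite_carrier by (simp add: flags_P)
qed

definition adjacent :: "nat \<Rightarrow> nat flag \<Rightarrow> nat flag \<Rightarrow> bool" where
  "adjacent i \<Phi> \<Psi> \<longleftrightarrow> \<Psi> \<in> flags P \<and> (\<forall>j\<in>{0, 1, 2}. flag_elem \<Psi> j \<noteq> flag_elem \<Phi> j \<longleftrightarrow> j = i)"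

lemma adjacent_unique_iff:
  assumes "\<Psi> \<in> flags P" "\<forall>j\<in>{0, 1, 2}. flag_elem \<Psi> j \<noteq> flag_elem \<Phi> j \<longleftrightarrow> j = i"
    and "\<And>\<Psi>'. \<Psi>' \<in> flags P \<Longrightarrow> \<forall>j\<in>{0, 1, 2}. flag_elem \<Psi>' j \<noteq> flag_elem \<Phi> j \<longleftrightarrow> j = i \<Longrightarrow> \<Psi>' = \<Psi>"
  shows "adjacent i \<Phi> \<Psi>' \<longleftrightarrow> \<Psi>' = \<Psi>"
  unfolding adjacent_def using assms by blast

lemma adj_flag_adjacent: "adj_flag P i \<Phi> = (THE \<Psi>. adjacent i \<Phi> \<Psi>)"
  unfolding adj_flag_def adjacent_def ..

lemma xy_xy [simp]: "g \<in> carrier G \<Longrightarrow> x \<otimes> y \<otimes> (x \<otimes> y \<otimes> g) = g"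
  using xy_involution by (simp add: m_assoc[symmetric])

lemma F_y_xy [simp]: "g \<in> carrier G \<Longrightarrow> F (y \<otimes> (x \<otimes> y \<otimes> g)) = F g"
  using F_flip[of "x \<otimes> y \<otimes> g"] by simp

lemma y_inv_y [simp]: "g \<in> carrier G \<Longrightarrow> y \<otimes> (inv y \<otimes> g) = g" "g \<in> carrier G \<Longrightarrow> inv y \<otimes> (y \<otimes> g) = g"
  by (simp_all add: m_assoc[symmetric])

lemma E_y_neq [simp]:
  assumes "g \<in> carrier G"
  shows "E (y \<otimes> g) \<noteq> E g" "E (inv y \<otimes> g) \<noteq> E g"
  using VE_inj[of "y \<otimes> g" g] VE_inj[of "inv y \<otimes> g" g] assms y_not_one by auto

lemma EF_flip_inj:
  assumes "a \<in> carrier G" "b \<in> carrier G" "E a = E b" "F (y \<otimes> a) = F b"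
  shows "a = x \<otimes> y \<otimes> b"
proof -
  have "x \<otimes> y \<otimes> a = b" using assms by (intro EF_inj) auto
  then show ?thesis using assms by auto
qed

lemma EF_y_inj:
  assumes "a \<in> carrier G" "b \<in> carrier G" "E a = E b" "F (y \<otimes> a) = F (y \<otimes> b)"
  shows "a = b"
proof -
  have "x \<otimes> y \<otimes> a = x \<otimes> y \<otimes> b" using assms by (intro EF_inj) auto
  then show ?thesis using assms by auto
qed

lemma VF_y_inj:
  assumes "a \<in> carrier G" "b \<in> carrier G" "V a = V b" "F (y \<otimes> a) = F (y \<otimes> b)"
  shows "a = b"
  using VF_inj[of "y \<otimes> a" "y \<otimes> b"] assms by auto

lemma VF_flip_inj:
  assumes "a \<in> carrier G" "b \<in> carrier G" "V a = V b" "F (y \<otimes> a) = F b"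
  shows "b = y \<otimes> a"
  using VF_inj[of "y \<otimes> a" b] assms by auto

text \<open>Each candidate keeps two members of \<open>W g\<close>: \<open>x y g\<close> has the
  edge of \<open>g\<close>, \<open>inv y g\<close> has its vertex, and in both cases the extra
  \<open>y\<close> in the face of a \<open>B\<close> flag restores \<open>F g\<close>. For
  uniqueness, two members of a flag determine the group element within each class.\<close>

lemma adjacent_W:
  assumes g: "g \<in> carrier G"
  shows "adjacent 0 (W g) \<Theta> \<longleftrightarrow> \<Theta> = B (x \<otimes> y \<otimes> g)"
    and "adjacent 1 (W g) \<Theta> \<longleftrightarrow> \<Theta> = B (inv y \<otimes> g)"
    and "adjacent 2 (W g) \<Theta> \<longleftrightarrow> \<Theta> = B g"
proof -
  show "adjacent 0 (W g) \<Theta> \<longleftrightarrow> \<Theta> = B (x \<otimes> y \<otimes> g)"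
  proof (rule adjacent_unique_iff)
    fix \<Psi> assume "\<Psi> \<in> flags P" and *: "\<forall>j\<in>{0, 1, 2}. flag_elem \<Psi> j \<noteq> flag_elem (W g) j \<longleftrightarrow> j = 0"
    then show "\<Psi> = B (x \<otimes> y \<otimes> g)"
    proof (cases rule: flags_cases)
      case (1 h)
      with * g show ?thesis using EF_inj[of h g] by (auto simp: W_def)
    next
      case (2 h)
      with * g show ?thesis using EF_flip_inj[of h g] by (auto simp: W_def B_def)
    qed
  qed (use g in simp, use g in \<open>auto simp: W_def B_def\<close>)
  show "adjacent 1 (W g) \<Theta> \<longleftrightarrow> \<Theta> = B (inv y \<otimes> g)"
  proof (rule adjacent_unique_iff)
    fix \<Psi> assume "\<Psi> \<in> flags P" and *: "\<forall>j\<in>{0, 1, 2}. flag_elem \<Psi> j \<noteq> flag_elem (W g) j \<longleftrightarrow> j = 1"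
    then show "\<Psi> = B (inv y \<otimes> g)"
    proof (cases rule: flags_cases)
      case (1 h)
      with * g show ?thesis using VF_inj[of h g] by (auto simp: W_def)
    next
      case (2 h)
      with * g show ?thesis using VF_flip_inj[of h g] by (auto simp: W_def B_def)
    qed
  qed (use g in simp, use g in \<open>auto simp: W_def B_def\<close>)
  show "adjacent 2 (W g) \<Theta> \<longleftrightarrow> \<Theta> = B g"
  proof (rule adjacent_unique_iff)
    fix \<Psi> assume "\<Psi> \<in> flags P" and *: "\<forall>j\<in>{0, 1, 2}. flag_elem \<Psi> j \<noteq> flag_elem (W g) j \<longleftrightarrow> j = 2"
    then show "\<Psi> = B g"
    proof (cases rule: flags_cases)
      case (1 h)
      with * g show ?thesis using VE_inj[of h g] by (auto simp: W_def)
    next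
      case (2 h)
      with * g show ?thesis using VE_inj[of h g] by (auto simp: W_def B_def)
    qed
  qed (use g in simp, use g in \<open>auto simp: W_def B_def\<close>)
qed

lemma adjacent_B:
  assumes g: "g \<in> carrier G"
  shows "adjacent 0 (B g) \<Theta> \<longleftrightarrow> \<Theta> = W (x \<otimes> y \<otimes> g)"
    and "adjacent 1 (B g) \<Theta> \<longleftrightarrow> \<Theta> = W (y \<otimes> g)"
    and "adjacent 2 (B g) \<Theta> \<longleftrightarrow> \<Theta> = W g"
proof -
  show "adjacent 0 (B g) \<Theta> \<longleftrightarrow> \<Theta> = W (x \<otimes> y \<otimes> g)"
  proof (rule adjacent_unique_iff)
    fix \<Psi> assume "\<Psi> \<in> flags P" and *: "\<forall>j\<in>{0, 1, 2}. flag_elem \<Psi> j \<noteq> flag_elem (B g) j \<longleftrightarrow> j = 0"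
    then show "\<Psi> = W (x \<otimes> y \<otimes> g)"
    proof (cases rule: flags_cases)
      case (1 h)
      with * g have "E h = E (x \<otimes> y \<otimes> g)" "F h = F (x \<otimes> y \<otimes> g)" by (auto simp: W_def B_def)
      then show ?thesis using 1 g EF_inj[of h "x \<otimes> y \<otimes> g"] by simp
    next
      case (2 h)
      with * g show ?thesis using EF_y_inj[of h g] by (auto simp: B_def)
    qed
  qed (use g in simp, use g in \<open>auto simp: W_def B_def\<close>)
  show "adjacent 1 (B g) \<Theta> \<longleftrightarrow> \<Theta> = W (y \<otimes> g)"
  proof (rule adjacent_unique_iff)
    fix \<Psi> assume "\<Psi> \<in> flags P" and *: "\<forall>j\<in>{0, 1, 2}. flag_elem \<Psi> j \<noteq> flag_elem (B g) j \<longleftrightarrow> j = 1"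
    then show "\<Psi> = W (y \<otimes> g)"
    proof (cases rule: flags_cases)
      case (1 h)
      with * g show ?thesis using VF_inj[of h "y \<otimes> g"] by (auto simp: W_def B_def)
    next
      case (2 h)
      with * g show ?thesis using VF_y_inj[of h g] by (auto simp: B_def)
    qed
  qed (use g in simp, use g in \<open>auto simp: W_def B_def\<close>)
  show "adjacent 2 (B g) \<Theta> \<longleftrightarrow> \<Theta> = W g"
  proof (rule adjacent_unique_iff)
    fix \<Psi> assume "\<Psi> \<in> flags P" and *: "\<forall>j\<in>{0, 1, 2}. flag_elem \<Psi> j \<noteq> flag_elem (B g) j \<longleftrightarrow> j = 2"
    then show "\<Psi> = W g"
    proof (cases rule: flags_cases)
      case (1 h)
      with * g show ?thesis using VE_inj[of h g] by (auto simp: W_def B_def)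
    next
      case (2 h)
      with * g show ?thesis using VE_inj[of h g] by (auto simp: B_def)
    qed
  qed (use g in simp, use g in \<open>auto simp: W_def B_def\<close>)
qed

lemma adj_W:
  assumes "g \<in> carrier G"
  shows "adj_flag P 0 (W g) = B (x \<otimes> y \<otimes> g)"
    and "adj_flag P 1 (W g) = B (inv y \<otimes> g)"
    and "adj_flag P 2 (W g) = B g"
  unfolding adj_flag_adjacent adjacent_W[OF assms] by simp_all

lemma adj_B:
  assumes "g \<in> carrier G"
  shows "adj_flag P 0 (B g) = W (x \<otimes> y \<otimes> g)"
    and "adj_flag P 1 (B g) = W (y \<otimes> g)"
    and "adj_flag P 2 (B g) = W g"
  unfolding adj_flag_adjacent adjacent_B[OF assms] by simp_all

lemma adjacent_iff:
  assumes "\<Phi> \<in> flags P" "i \<in> {0, 1, 2}"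
  shows "adjacent i \<Phi> \<Psi> \<longleftrightarrow> \<Psi> = adj_flag P i \<Phi>"
  using assms(1)
proof (cases rule: flags_cases)
  case (1 g)
  then show ?thesis using assms(2) by (elim insertE) (simp_all only: adjacent_W adj_W empty_iff)
next
  case (2 g)
  then show ?thesis using assms(2) by (elim insertE) (simp_all only: adjacent_B adj_B empty_iff)
qed

lemma adj_flag_flag: "\<Phi> \<in> flags P \<Longrightarrow> i \<in> {0, 1, 2} \<Longrightarrow> adj_flag P i \<Phi> \<in> flags P"
  using adjacent_iff[of \<Phi> i "adj_flag P i \<Phi>"] by (simp only: adjacent_def simp_thms)

lemma W_rotate:
  assumes g: "g \<in> carrier G"
  shows "adj_flag P 0 (adj_flag P 1 (W g)) = W (x \<otimes> g)"
    and "adj_flag P 1 (adj_flag P 2 (W g)) = W (y \<otimes> g)"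
  using g adj_W(2)[of g] adj_B(2)[of g] adj_W(2)[of "y \<otimes> g"]
  by (simp_all add: adj_W adj_B m_assoc)

text \<open>On the \<open>B\<close> class the rotations multiply by \<open>x y y\<close> and
  \<open>inv y\<close>. Conjugated by \<open>y\<close>, these are \<open>y x y = inv x\<close> and
  \<open>inv y\<close>, the values of the reflection constructed later.\<close>

lemma B_rotate:
  assumes g: "g \<in> carrier G"
  shows "adj_flag P 0 (adj_flag P 1 (B g)) = B (x \<otimes> y \<otimes> y \<otimes> g)"
    and "adj_flag P 1 (adj_flag P 2 (B g)) = B (inv y \<otimes> g)"
  using g adj_W(2)[of g] adj_B(2)[of g] adj_W(2)[of "y \<otimes> g"]
  by (simp_all add: adj_W adj_B m_assoc)

text \<open>The edges on \<open>F g\<close> are the \<open>E (h g)\<close> with \<open>h\<close> in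
  \<open><x>\<close>, and \<open>EF_inj\<close> makes \<open>h\<close> unique, so their number is
  the order of \<open>x\<close>. Vertices are treated alike with \<open><y>\<close> and
  \<open>VE_inj\<close>.\<close>

theorem has_type_P: "has_type P (ord x) (ord y)"
proof -
  have "{e \<in> of_rank P 1. incident P e (F g)} = (\<lambda>h. E (h \<otimes> g)) ` generate G {x}" (is "?l = ?r")
    and "inj_on (\<lambda>h. E (h \<otimes> g)) (generate G {x})" if g: "g \<in> carrier G" for g
  proof -
    show "?l = ?r"
    proof (intro equalityI subsetI)
      fix e assume "e \<in> ?l"
      then obtain a where "a \<in> carrier G" "e = E a" "F a = F g"
        by (auto simp: of_rank_P incident_EF)
      then show "e \<in> ?r" using g by (auto simp: F_eq_iff)
    next
      fix e assume "e \<in> ?r"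
      then obtain h where h: "h \<in> generate G {x}" "e = E (h \<otimes> g)" by auto
      then have "h \<otimes> g \<in> carrier G" "F (h \<otimes> g) = F g"
        using g generate_subset(1) F_eq_iff[of "h \<otimes> g" g] by auto
      then show "e \<in> ?l" using h flag_incident(3)[of "h \<otimes> g"] by (auto simp: of_rank_P)
    qed
    show "inj_on (\<lambda>h. E (h \<otimes> g)) (generate G {x})"
    proof (rule inj_onI)
      fix h h' assume h: "h \<in> generate G {x}" "h' \<in> generate G {x}" "E (h \<otimes> g) = E (h' \<otimes> g)"
      then have c: "h \<in> carrier G" "h' \<in> carrier G" using generate_subset(1) by auto
      then have "F (h \<otimes> g) = F g" "F (h' \<otimes> g) = F g"
        using h g F_eq_iff[of "h \<otimes> g" g] F_eq_iff[of "h' \<otimes> g" g] by auto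
      then have "h \<otimes> g = h' \<otimes> g" using h c g by (intro EF_inj) auto
      then show "h = h'" using c g by simp
    qed
  qed
  moreover have "{e \<in> of_rank P 1. incident P (V g) e} = (\<lambda>h. E (h \<otimes> g)) ` generate G {y}" (is "?l = ?r")
    and "inj_on (\<lambda>h. E (h \<otimes> g)) (generate G {y})" if g: "g \<in> carrier G" for g
  proof -
    show "?l = ?r"
    proof (intro equalityI subsetI)
      fix e assume "e \<in> ?l"
      then obtain a where "a \<in> carrier G" "e = E a" "V a = V g"
        by (auto simp: of_rank_P incident_VE)
      then show "e \<in> ?r" using g by (auto simp: V_eq_iff)
    next
      fix e assume "e \<in> ?r"
      then obtain h where h: "h \<in> generate G {y}" "e = E (h \<otimes> g)" by auto
      then have "h \<otimes> g \<in> carrier G" "V (h \<otimes> g) = V g"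
        using g generate_subset(2) V_eq_iff[of "h \<otimes> g" g] by auto
      then show "e \<in> ?l" using h flag_incident(1)[of "h \<otimes> g"] by (auto simp: of_rank_P)
    qed
    show "inj_on (\<lambda>h. E (h \<otimes> g)) (generate G {y})"
    proof (rule inj_onI)
      fix h h' assume h: "h \<in> generate G {y}" "h' \<in> generate G {y}" "E (h \<otimes> g) = E (h' \<otimes> g)"
      then have c: "h \<in> carrier G" "h' \<in> carrier G" using generate_subset(2) by auto
      then have "V (h \<otimes> g) = V g" "V (h' \<otimes> g) = V g"
        using h g V_eq_iff[of "h \<otimes> g" g] V_eq_iff[of "h' \<otimes> g" g] by auto
      then have "h \<otimes> g = h' \<otimes> g" using h c g by (intro VE_inj) auto
      then show "h = h'" using c g by simp
    qed
  qed
  moreover have "finite (generate G {x})" "finite (generate G {y})"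
    using generate_subset finite_carrier by (auto intro: finite_subset)
  ultimately show ?thesis
    unfolding has_type_def by (auto simp: of_rank_P(1,4) card_image generate_pow_card)
qed

section \<open>Right translations as automorphisms\<close>

definition translation :: "'a \<Rightarrow> nat \<Rightarrow> nat" where
  "translation g = (\<lambda>n\<in>elems P.
     if n \<in> V ` carrier G then V (inv_into (carrier G) V n \<otimes> g)
     else if n \<in> E ` carrier G then E (inv_into (carrier G) E n \<otimes> g)
     else F (inv_into (carrier G) F n \<otimes> g))"

text \<open>By \<open>right_translate\<close> the representative picked by \<open>inv_into\<close>
  does not matter.\<close>

lemma translation_apply [simp]:
  assumes h: "h \<in> carrier G" and g: "g \<in> carrier G"
  shows "translation g (V h) = V (h \<otimes> g)" "translation g (E h) = E (h \<otimes> g)"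
    "translation g (F h) = F (h \<otimes> g)"
proof -
  have neq: "E h \<notin> V ` carrier G" "F h \<notin> V ` carrier G" "F h \<notin> E ` carrier G" by auto
  have *: "inv_into (carrier G) L (L h) \<in> carrier G" "L (inv_into (carrier G) L (L h)) = L h" for L :: "'a \<Rightarrow> nat"
    using h by (auto intro: inv_into_into f_inv_into_f)
  show "translation g (V h) = V (h \<otimes> g)"
    using h right_translate(1)[OF *(1) h g] *(2) by (simp add: translation_def)
  show "translation g (E h) = E (h \<otimes> g)"
    using h neq right_translate(2)[OF *(1) h g] *(2) by (simp add: translation_def)
  show "translation g (F h) = F (h \<otimes> g)"
    using h neq right_translate(3)[OF *(1) h g] *(2) by (simp add: translation_def)
qed

lemma translation_elems: "g \<in> carrier G \<Longrightarrow> n \<in> elems P \<Longrightarrow> translation g n \<in> elems P"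
  by (erule elems_P_cases) auto

lemma translation_inv:
  assumes "g \<in> carrier G" "n \<in> elems P"
  shows "translation (inv g) (translation g n) = n" "translation g (translation (inv g) n) = n"
  using assms(2) by (cases rule: elems_P_cases; use assms(1) in \<open>simp add: m_assoc\<close>)+

lemma translation_ord:
  assumes g: "g \<in> carrier G" and "(u, v) \<in> ranked_poset.ord P"
  shows "(translation g u, translation g v) \<in> ranked_poset.ord P"
proof (cases "u = v")
  case True
  then show ?thesis using assms translation_elems[OF g] by (auto simp: ord_P_iff)
next
  case False
  then obtain h where h: "h \<in> carrier G" "u = V h \<and> v = E h \<or> u = E h \<and> v = F h \<or> u = V h \<and> v = F h"
    using assms(2) unfolding ord_P_iff by blast
  then have "h \<otimes> g \<in> carrier G" using g by simp
  then show ?thesis unfolding ord_P_iff using h g by auto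
qed

lemma translation_aut:
  assumes g: "g \<in> carrier G"
  shows "translation g \<in> carrier (aut_group P)"
proof -
  have "bij_betw (translation g) (elems P) (elems P)"
    by (rule bij_betw_byWitness[where f' = "translation (inv g)"])
      (use g in \<open>auto simp: translation_inv translation_elems\<close>)
  moreover have "translation g \<in> extensional (elems P)"
    by (simp add: translation_def)
  moreover have "(translation g u, translation g v) \<in> ranked_poset.ord P \<longleftrightarrow> (u, v) \<in> ranked_poset.ord P"
    if "u \<in> elems P" "v \<in> elems P" for u v
    using translation_ord[OF g, of u v] translation_ord[of "inv g" "translation g u" "translation g v"] g that
    by (auto simp: translation_inv)
  ultimately show ?thesis by (simp add: aut_group_def Bij_def)
qed

lemma flag_image_translation:
  assumes "h \<in> carrier G" "g \<in> carrier G"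
  shows "flag_image (translation g) (W h) = W (h \<otimes> g)" "flag_image (translation g) (B h) = B (h \<otimes> g)"
  using assms by (simp_all add: flag_image_def W_def B_def m_assoc)

text \<open>\<open>aut_group\<close> applies the left factor first, which matches right
  multiplication by \<open>g\<close> and then by \<open>h\<close>.\<close>

lemma translation_mult:
  assumes "g \<in> carrier G" "h \<in> carrier G"
  shows "translation (g \<otimes> h) = compose (elems P) (translation h) (translation g)"
proof (rule extensionalityI[of _ "elems P"])
  fix n assume n: "n \<in> elems P"
  then show "translation (g \<otimes> h) n = compose (elems P) (translation h) (translation g) n"
    by (cases rule: elems_P_cases) (use assms n in \<open>simp_all add: compose_def m_assoc\<close>)
qed (simp_all add: translation_def compose_def)

section \<open>Arbitrary automorphisms\<close>

context
  fixes f assumes f: "f \<in> carrier (aut_group P)"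
begin

lemma aut_bij: "bij_betw f (elems P) (elems P)" and aut_extensional: "f \<in> extensional (elems P)"
  and aut_ord: "\<And>u v. u \<in> elems P \<Longrightarrow> v \<in> elems P \<Longrightarrow>
    (f u, f v) \<in> ranked_poset.ord P \<longleftrightarrow> (u, v) \<in> ranked_poset.ord P"
  using f by (auto simp: aut_group_def Bij_def)

lemma aut_elems: "u \<in> elems P \<Longrightarrow> f u \<in> elems P"
  using aut_bij by (auto simp: bij_betw_def)

lemma aut_eq_iff: "u \<in> elems P \<Longrightarrow> v \<in> elems P \<Longrightarrow> f u = f v \<longleftrightarrow> u = v"
  using aut_bij by (auto simp: bij_betw_def dest: inj_onD)

lemma aut_incident:
  "u \<in> elems P \<Longrightarrow> v \<in> elems P \<Longrightarrow> incident P (f u) (f v) \<longleftrightarrow> incident P u v"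
  by (simp add: incident_def aut_ord aut_elems aut_eq_iff)

text \<open>Every element lies in a chain of length three, so strict monotonicity forces ranks to be preserved.\<close>

lemma aut_rank:
  assumes "u \<in> elems P" shows "f u mod 3 = u mod 3"
proof -
  have mono: "f a mod 3 < f b mod 3" if "(a, b) \<in> ranked_poset.ord P" "a \<noteq> b" "a \<in> elems P" "b \<in> elems P" for a b
    using polyhedron_P that aut_ord[of a b] aut_eq_iff[of a b] by (simp add: polyhedron_def)
  have "f (V g) mod 3 = 0 \<and> f (E g) mod 3 = 1 \<and> f (F g) mod 3 = 2" if g: "g \<in> carrier G" for g
  proof -
    have "f (V g) mod 3 < f (E g) mod 3" "f (E g) mod 3 < f (F g) mod 3"
      using g by (auto intro!: mono simp: ord_P_iff)
    moreover have "f (F g) mod 3 < 3" by simp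
    ultimately show ?thesis by linarith
  qed
  with assms show ?thesis by (cases rule: elems_P_cases) simp_all
qed

lemma aut_of_rank: "u \<in> of_rank P i \<Longrightarrow> f u \<in> of_rank P i"
  by (simp add: of_rank_def aut_elems aut_rank)

lemma aut_flag: "\<Phi> \<in> flags P \<Longrightarrow> flag_image f \<Phi> \<in> flags P"
  by (auto simp: flags_def flag_image_def aut_of_rank aut_incident)
    (auto simp: aut_incident incident_def aut_ord aut_elems aut_eq_iff)

lemma flag_elem_image: "flag_elem (flag_image f \<Phi>) j = f (flag_elem \<Phi> j)"
  by (cases \<Phi>) (simp add: flag_image_def)

lemma flag_elem_elems: "\<Phi> \<in> flags P \<Longrightarrow> flag_elem \<Phi> j \<in> elems P"
  by (auto simp: flags_def of_rank_def)

lemma aut_adj: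
  assumes "\<Phi> \<in> flags P" "i \<in> {0, 1, 2}"
  shows "flag_image f (adj_flag P i \<Phi>) = adj_flag P i (flag_image f \<Phi>)"
proof -
  let ?\<Psi> = "adj_flag P i \<Phi>"
  have \<Psi>: "?\<Psi> \<in> flags P" "\<And>j. j \<in> {0, 1, 2} \<Longrightarrow> flag_elem ?\<Psi> j \<noteq> flag_elem \<Phi> j \<longleftrightarrow> j = i"
    using adjacent_iff[OF assms, of ?\<Psi>] unfolding adjacent_def by blast+
  have "adjacent i (flag_image f \<Phi>) (flag_image f ?\<Psi>)"
    unfolding adjacent_def
  proof (intro conjI ballI)
    fix j :: nat assume "j \<in> {0, 1, 2}"
    from \<Psi>(2)[OF this]
    show "flag_elem (flag_image f ?\<Psi>) j \<noteq> flag_elem (flag_image f \<Phi>) j \<longleftrightarrow> j = i"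
      by (simp only: flag_elem_image aut_eq_iff flag_elem_elems \<Psi>(1) assms(1))
  qed (rule aut_flag[OF \<Psi>(1)])
  then show ?thesis using adjacent_iff[OF aut_flag[OF assms(1)] assms(2)] by simp
qed

lemma aut_rotate:
  assumes "\<Phi> \<in> flags P"
  shows "flag_image f (adj_flag P 0 (adj_flag P 1 \<Phi>)) = adj_flag P 0 (adj_flag P 1 (flag_image f \<Phi>))"
    and "flag_image f (adj_flag P 1 (adj_flag P 2 \<Phi>)) = adj_flag P 1 (adj_flag P 2 (flag_image f \<Phi>))"
  by (simp_all only: aut_adj adj_flag_flag assms insert_iff simp_thms)

end

text \<open>In a finite group \<open>inv s\<close> is the power \<open>s^(ord s - 1)\<close>, so
  positive words in \<open>x\<close> and \<open>y\<close> already reach every element.\<close>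

lemma left_mult_induct [consumes 1, case_names one x y]:
  assumes "g \<in> carrier G" "Q \<one>"
    and "\<And>h. h \<in> carrier G \<Longrightarrow> Q h \<Longrightarrow> Q (x \<otimes> h)"
    and "\<And>h. h \<in> carrier G \<Longrightarrow> Q h \<Longrightarrow> Q (y \<otimes> h)"
  shows "Q g"
proof -
  have "Q (h \<otimes> u)" if "h \<in> generate G {x, y}" "u \<in> carrier G" "Q u" for h u
    using that
  proof (induction arbitrary: u)
    case (inv s)
    then have s: "s \<in> carrier G" by auto
    have "Q (s [^] n \<otimes> u)" for n :: nat
    proof (induction n)
      case (Suc n)
      have "s [^] Suc n \<otimes> u = s \<otimes> (s [^] n \<otimes> u)"
        using s inv.prems(1) by (simp only: nat_pow_Suc2 m_assoc nat_pow_closed)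
      then show ?case using Suc assms(3,4) inv s by auto
    qed (use inv in simp)
    moreover have "inv s = s [^] (ord s - 1)"
    proof (rule inv_equality)
      have "s [^] (ord s - 1) \<otimes> s = s [^] Suc (ord s - 1)" by simp
      then show "s [^] (ord s - 1) \<otimes> s = \<one>"
        using ord_ge_1[OF finite_carrier s] s by (simp del: nat_pow_Suc)
    qed (use s in simp_all)
    ultimately show ?case by metis
  next
    case (eng h1 h2)
    then have "h1 \<in> carrier G" "h2 \<in> carrier G" by (auto simp: generated)
    then show ?case using eng by (simp add: m_assoc)
  qed (use assms in auto)
  from this[of g \<one>] assms(1,2) show ?thesis by (simp add: generated)
qed

text \<open>Automorphisms commute with flag adjacency, hence with the rotations \<open>W h\<close>
  to \<open>W (x h)\<close> and \<open>W (y h)\<close>. Induction along words carries the value at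
  the base flag to all \<open>W h\<close>, whose members exhaust the polyhedron.\<close>

lemma aut_translation:
  assumes f: "f \<in> carrier (aut_group P)" and g: "g \<in> carrier G" and "flag_image f (W \<one>) = W g"
  shows "f = translation g"
proof -
  have W: "flag_image f (W h) = W (h \<otimes> g)" if "h \<in> carrier G" for h
    using that
  proof (induction rule: left_mult_induct)
    case (x h)
    with aut_rotate(1)[OF f W_flag[OF x(1)]] show ?case
      using g by (simp only: W_rotate m_closed m_assoc x_closed)
  next
    case (y h)
    with aut_rotate(2)[OF f W_flag[OF y(1)]] show ?case
      using g by (simp only: W_rotate m_closed m_assoc y_closed)
  qed (use assms in simp)
  show ?thesis
  proof (rule extensionalityI[of _ "elems P"])
    fix n assume "n \<in> elems P"
    then show "f n = translation g n"
      by (cases rule: elems_P_cases) (use W g in \<open>simp_all add: W_def flag_image_def\<close>)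
  qed (simp_all add: aut_extensional[OF f] translation_def)
qed

text \<open>Commuting with the rotations, such an automorphism sends every \<open>W h\<close> to
  some \<open>B (\<tau> h)\<close>, and \<open>B_rotate\<close> prescribes how \<open>\<tau>\<close>
  behaves under left multiplication by \<open>x\<close> and \<open>y\<close>. The homomorphism is
  read off from \<open>\<tau>\<close>.\<close>

lemma aut_reflection_hom:
  assumes f: "f \<in> carrier (aut_group P)" and b: "b \<in> carrier G" and fb: "flag_image f (W \<one>) = B b"
  shows "\<exists>\<rho>\<in>hom G G. \<rho> x = inv x \<and> \<rho> y = inv y"
proof -
  have ex: "\<exists>c\<in>carrier G. flag_image f (W h) = B c" if "h \<in> carrier G" for h
    using that
  proof (induction rule: left_mult_induct)
    case one
    show ?case using b fb by blast
  next
    case (x h)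
    with aut_rotate(1)[OF f W_flag[OF x(1)]] show ?case
      by (auto simp only: W_rotate B_rotate) (blast intro: m_closed x_closed y_closed)
  next
    case (y h)
    with aut_rotate(2)[OF f W_flag[OF y(1)]] show ?case
      by (auto simp only: W_rotate B_rotate) (blast intro: m_closed y_closed inv_closed)
  qed
  then obtain \<tau> where \<tau>: "\<And>h. h \<in> carrier G \<Longrightarrow> \<tau> h \<in> carrier G"
    and f\<tau>: "\<And>h. h \<in> carrier G \<Longrightarrow> flag_image f (W h) = B (\<tau> h)"
    by metis
  have \<tau>x: "\<tau> (x \<otimes> h) = x \<otimes> y \<otimes> y \<otimes> \<tau> h" and \<tau>y: "\<tau> (y \<otimes> h) = inv y \<otimes> \<tau> h" if h: "h \<in> carrier G" for h
  proof -
    have "B (\<tau> (x \<otimes> h)) = B (x \<otimes> y \<otimes> y \<otimes> \<tau> h)"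
      using aut_rotate(1)[OF f W_flag[OF h]] h
      by (simp only: W_rotate B_rotate f\<tau> \<tau> m_closed x_closed)
    then show "\<tau> (x \<otimes> h) = x \<otimes> y \<otimes> y \<otimes> \<tau> h" using h \<tau> by simp
    have "B (\<tau> (y \<otimes> h)) = B (inv y \<otimes> \<tau> h)"
      using aut_rotate(2)[OF f W_flag[OF h]] h
      by (simp only: W_rotate B_rotate f\<tau> \<tau> m_closed y_closed)
    then show "\<tau> (y \<otimes> h) = inv y \<otimes> \<tau> h" using h \<tau> by simp
  qed
  have \<tau>_mult: "\<tau> (g \<otimes> h) = \<tau> g \<otimes> inv \<tau> \<one> \<otimes> \<tau> h" if "g \<in> carrier G" and h: "h \<in> carrier G" for g h
    using that(1)
  proof (induction rule: left_mult_induct)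
    case (x g)
    then show ?case using h \<tau> by (simp add: m_assoc \<tau>x)
  next
    case (y g)
    then show ?case using h \<tau> by (simp add: m_assoc \<tau>y)
  qed (use h \<tau> in simp)
  \<comment> \<open>Dividing \<open>\<tau>\<close> on the right by \<open>\<tau> \<one>\<close>
    makes it multiplicative, with \<open>x\<close> going to \<open>x y y\<close> and
    \<open>y\<close> to \<open>inv y\<close>. Conjugation by \<open>y\<close> turns
    \<open>x y y\<close> into \<open>y x y = inv x\<close> and fixes \<open>inv y\<close>.\<close>
  define \<rho> where "\<rho> g = y \<otimes> \<tau> g \<otimes> inv \<tau> \<one> \<otimes> inv y" for g
  have "\<rho> \<in> hom G G"
  proof (rule homI)
    fix g h assume "g \<in> carrier G" "h \<in> carrier G"
    then show "\<rho> (g \<otimes> h) = \<rho> g \<otimes> \<rho> h"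
      using \<tau> by (simp add: \<rho>_def \<tau>_mult m_assoc)
  qed (simp add: \<rho>_def \<tau>)
  moreover have "\<rho> x = inv x"
    using \<tau>x[of \<one>] \<tau>[of \<one>] y_x_y by (simp add: \<rho>_def m_assoc)
  moreover have "\<rho> y = inv y"
    using \<tau>y[of \<one>] \<tau>[of \<one>] by (simp add: \<rho>_def m_assoc)
  ultimately show ?thesis by blast
qed

section \<open>The two flag orbits and the full automorphism group\<close>

context
  assumes no_reflection: "\<not> (\<exists>\<rho>\<in>hom G G. \<rho> x = inv x \<and> \<rho> y = inv y)"
begin

theorem chiral_P: "chiral P"
  unfolding chiral_def
proof (intro conjI exI ballI)
  show "polyhedron P" by (rule polyhedron_P)
  show "W ` carrier G \<noteq> {}" "B ` carrier G \<noteq> {}" by auto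
  show "W ` carrier G \<inter> B ` carrier G = {}" by auto
  show "W ` carrier G \<union> B ` carrier G = flags P" by (simp add: flags_P)
  show "\<Phi> \<in> W ` carrier G \<longleftrightarrow> adj_flag P i \<Phi> \<in> B ` carrier G" if "\<Phi> \<in> flags P" "i \<in> {0, 1, 2}" for \<Phi> i
    using that(1)
  proof (cases rule: flags_cases)
    case (1 g)
    then have "adj_flag P i \<Phi> \<in> B ` carrier G"
      using that(2) by (elim insertE) (auto simp only: adj_W intro!: imageI m_closed inv_closed x_closed y_closed)
    then show ?thesis using 1 by blast
  next
    case (2 g)
    then have "adj_flag P i \<Phi> \<in> W ` carrier G"
      using that(2) by (elim insertE) (auto simp only: adj_B intro!: imageI m_closed inv_closed x_closed y_closed)
    then show ?thesis using 2 by auto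
  qed
  show "flag_transitive P (W ` carrier G)"
    unfolding flag_transitive_def
  proof clarsimp
    fix a b assume "a \<in> carrier G" "b \<in> carrier G"
    then show "\<exists>g\<in>carrier (aut_group P). flag_image g (W a) = W b"
      by (intro bexI[of _ "translation (inv a \<otimes> b)"])
        (simp_all add: flag_image_translation translation_aut m_assoc[symmetric])
  qed
  show "flag_transitive P (B ` carrier G)"
    unfolding flag_transitive_def
  proof clarsimp
    fix a b assume "a \<in> carrier G" "b \<in> carrier G"
    then show "\<exists>g\<in>carrier (aut_group P). flag_image g (B a) = B b"
      by (intro bexI[of _ "translation (inv a \<otimes> b)"])
        (simp_all add: flag_image_translation translation_aut m_assoc[symmetric])
  qed
  show "\<not> flag_transitive P (flags P)"
    using aut_reflection_hom[OF _ one_closed] no_reflection W_flag[OF one_closed] B_flag[OF one_closed]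
    unfolding flag_transitive_def by blast
qed

theorem is_aut_group_of_P: "is_aut_group_of G x y P"
  unfolding is_aut_group_of_def
proof (rule bexI[of _ "W \<one>"], rule bexI[of _ translation], intro conjI)
  show "W \<one> \<in> flags P" by simp
  show "flag_image (translation x) (W \<one>) = adj_flag P 0 (adj_flag P 1 (W \<one>))"
    unfolding W_rotate(1)[OF one_closed] by (simp add: flag_image_translation)
  show "flag_image (translation y) (W \<one>) = adj_flag P 1 (adj_flag P 2 (W \<one>))"
    unfolding W_rotate(2)[OF one_closed] by (simp add: flag_image_translation)
  have "translation \<in> hom G (aut_group P)"
    by (rule homI, simp add: translation_aut, simp add: translation_mult aut_group_def)
  moreover have "inj_on translation (carrier G)"
  proof (rule inj_onI)
    fix a b assume ab: "a \<in> carrier G" "b \<in> carrier G" "translation a = translation b"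
    then have "W (\<one> \<otimes> a) = W (\<one> \<otimes> b)" by (metis flag_image_translation(1) one_closed)
    then show "a = b" using ab by simp
  qed
  \<comment> \<open>The image of the base flag decides: a \<open>W\<close> flag makes
    \<open>f\<close> a translation, a \<open>B\<close> flag would produce the excluded
    homomorphism.\<close>
  moreover have "f \<in> translation ` carrier G" if f: "f \<in> carrier (aut_group P)" for f
    using aut_flag[OF f W_flag[OF one_closed]]
  proof (cases rule: flags_cases)
    case (1 g)
    then show ?thesis using aut_translation[OF f] by blast
  next
    case (2 g)
    then show ?thesis using aut_reflection_hom[OF f] no_reflection by blast
  qed
  ultimately show "translation \<in> iso G (aut_group P)"
    unfolding iso_def bij_betw_def using translation_aut by blast
qed

end
end

section \<open>Presented groups\<close>

lemma presented_carrier: "carrier (presented_group R) = range (word_class R)"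
  and presented_one: "\<one>\<^bsub>presented_group R\<^esub> = word_class R []"
  by (simp_all add: presented_group_def)

lemma presented_gen_closed [simp]: "presented_gen R s \<in> carrier (presented_group R)"
  by (simp add: presented_carrier presented_gen_def)

lemma presented_gen_inv: "word_class R [(s, True)] = inv\<^bsub>presented_group R\<^esub> presented_gen R s"
proof -
  interpret group "presented_group R" by (rule group_presented_group)
  have "word_eq R [(s, True), (s, False)] []"
    using word_eq.cancel[of R "[]" s True "[]"] by simp
  then show ?thesis
    by (intro inv_equality[symmetric])
      (simp_all add: presented_gen_def presented_group_mult presented_one word_class_eq_iff
        presented_carrier rangeI)
qed

lemma word_class_letter:
  "word_class R [(s, b)] = (if b then inv\<^bsub>presented_group R\<^esub> presented_gen R s else presented_gen R s)"
  by (simp add: presented_gen_inv) (simp add: presented_gen_def)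

lemma word_class_replicate:
  "word_class R (replicate n (s, b)) = word_class R [(s, b)] [^]\<^bsub>presented_group R\<^esub> n"
proof (induction n)
  case 0
  show ?case by (simp add: presented_one)
next
  case (Suc n)
  have "replicate (Suc n) (s, b) = replicate n (s, b) @ [(s, b)]"
    by (simp add: replicate_append_same)
  then show ?case by (simp only: presented_group_mult[symmetric] Suc nat_pow_Suc)
qed

lemma word_class_gen_power:
  "word_class R (gen_power s i) = presented_gen R s [^]\<^bsub>presented_group R\<^esub> i"
proof -
  interpret group "presented_group R" by (rule group_presented_group)
  show ?thesis
    unfolding gen_power_def word_class_replicate word_class_letter int_pow_def2
    by (cases "i < 0") (simp_all add: nat_pow_inv int_pow_inv)
qed

lemma presented_generated: "generate (presented_group R) (range (presented_gen R)) = carrier (presented_group R)"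
proof -
  interpret group "presented_group R" by (rule group_presented_group)
  have "word_class R w \<in> generate (presented_group R) (range (presented_gen R))" for w
  proof (induction w)
    case Nil
    show ?case unfolding presented_one[symmetric] by (rule generate.one)
  next
    case (Cons l w)
    obtain s b where l: "l = (s, b)" by fastforce
    have "word_class R [l] \<in> generate (presented_group R) (range (presented_gen R))"
      unfolding l word_class_letter by (auto intro: generate.incl generate.inv)
    from generate.eng[OF this Cons] show ?case by (simp add: presented_group_mult)
  qed
  moreover have "generate (presented_group R) (range (presented_gen R)) \<subseteq> carrier (presented_group R)"
    by (rule generate_incl) auto
  ultimately show ?thesis by (auto simp: presented_carrier)
qed

text \<open>Each elementary rewriting preserves the result up to \<open>sim\<close>, and since
  letters respect \<open>sim\<close> it may take place inside a longer word. Working up to an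
  equivalence lets integer pairs stand for pairs of residues.\<close>

lemma word_eq_fold:
  assumes "equivp sim"
    and "\<And>l s t. sim s t \<Longrightarrow> sim (act l s) (act l t)"
    and "\<And>a b s. sim (act (a, \<not> b) (act (a, b) s)) s"
    and "\<And>l r s. (l, r) \<in> R \<Longrightarrow> sim (fold act l s) (fold act r s)"
    and "word_eq R v w"
  shows "sim (fold act v s) (fold act w s)"
proof -
  have cong: "sim (fold act u s) (fold act u t)" if "sim s t" for u s t
    using that by (induction u arbitrary: s t) (auto intro: assms(2))
  show ?thesis
    using assms(5)
  proof (induction arbitrary: s)
    case (cancel u a b v)
    show ?case using cong[OF assms(3)] by simp
  next
    case (relation l r u v)
    show ?case using cong[OF assms(4)[OF relation]] by simp
  qed (use assms(1) in \<open>blast dest: equivp_reflp equivp_symp equivp_transp\<close>)+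
qed

section \<open>The group of the theorem\<close>

text \<open>The pair \<open>(i, j)\<close> stands for the element \<open>x\<^sup>i y\<^sup>j\<close>, and the letters act by right multiplication.
  Here \<open>2 d\<close> replaces the exponent \<open>c\<close>, which gives \<open>y\<^sup>j x = x\<^bsup>1-2j\<^esup> y\<^bsup>-j+dj(j-1)\<^esup>\<close>.\<close>

fun act :: "int \<Rightarrow> sigma \<times> bool \<Rightarrow> int \<times> int \<Rightarrow> int \<times> int" where
  "act d (Sigma1, False) (i, j) = (i + 1 - 2 * j, - j + d * (j * (j - 1)))"
| "act d (Sigma1, True) (i, j) = (i - 1 - 2 * j, - j + d * (j * (j + 1)))"
| "act d (Sigma2, False) (i, j) = (i, j + 1)"
| "act d (Sigma2, True) (i, j) = (i, j - 1)"

section \<open>The action on pairs of residues and the defining relations\<close>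

definition pcong :: "int \<Rightarrow> int \<Rightarrow> int \<times> int \<Rightarrow> int \<times> int \<Rightarrow> bool" where
  "pcong p q s t \<longleftrightarrow> p dvd (fst s - fst t) \<and> q dvd (snd s - snd t)"

lemma equivp_pcong: "equivp (pcong p q)"
proof (rule equivpI)
  show "reflp (pcong p q)" by (simp add: reflp_def pcong_def)
  show "symp (pcong p q)" by (auto simp: symp_def pcong_def dvd_diff_commute)
  show "transp (pcong p q)"
    unfolding transp_def pcong_def by (metis (no_types, lifting) diff_add_cancel add_diff_eq dvd_add)
qed

lemma fold_gen_power_Sigma2: "fold (act d) (gen_power Sigma2 e) (i, j) = (i, j + e)"
proof -
  have "fold (act d) (replicate n (Sigma2, b)) (i, j) = (i, if b then j - int n else j + int n)" for n b
    by (induction n arbitrary: j) (cases b; auto)+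
  then show ?thesis by (simp add: gen_power_def)
qed

lemma fold_gen_power_Sigma1_zero: "fold (act d) (gen_power Sigma1 e) (i, 0) = (i + e, 0)"
proof -
  have "fold (act d) (replicate n (Sigma1, b)) (i, 0) = (if b then i - int n else i + int n, 0)" for n b
    by (induction n arbitrary: i) (cases b; auto)+
  then show ?thesis by (simp add: gen_power_def)
qed

text \<open>The arithmetic behind the action, for \<open>d\<close> a half of \<open>c\<close> modulo
  \<open>n\<close>. In the first coordinate \<open>2 d\<close> vanishes modulo \<open>2 m\<close>;
  in the second, \<open>d^2\<close> and \<open>m d\<close> vanish modulo \<open>n\<close> and
  \<open>2 d\<close> equals \<open>c\<close>.\<close>

locale gamma_params =
  fixes m n d c :: int
  assumes m_n: "m dvd n" and m_d: "m dvd d" and n_md: "n dvd m * d" and n_dd: "n dvd d * d"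
    and n_2d: "n dvd 2 * d - c"
begin

abbreviation pair_cong (infix "\<approx>" 50) where "pair_cong \<equiv> pcong (2 * m) n"

text \<open>The listed terms vanish modulo \<open>2 m\<close> and modulo \<open>n\<close>
  respectively, so a congruence reduces to a polynomial identity with explicit cofactors, which the
  later uses supply.\<close>

lemma pair_congI:
  assumes "i - i' = 2 * m * a1 + 2 * d * a2 + 2 * n * a3"
    and "j - j' = n * b1 + d * d * b2 + (2 * d - c) * b3 + m * d * b4"
  shows "(i, j) \<approx> (i', j')"
  unfolding pcong_def fst_conv snd_conv assms
  using m_n m_d n_md n_dd n_2d by (simp add: dvd_add)

lemma act_cong:
  assumes "s \<approx> t" shows "act d l s \<approx> act d l t"
proof -
  obtain i j i' j' where st: "s = (i, j)" "t = (i', j')" by fastforce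
  obtain a where a: "i = i' + 2 * m * a" using assms by (auto simp: pcong_def st dvd_def algebra_simps)
  obtain b where b: "j = j' + n * b" using assms by (auto simp: pcong_def st dvd_def algebra_simps)
  obtain g r where l: "l = (g, r)" by fastforce
  show ?thesis
  proof (cases g; cases r)
    \<comment> \<open>Replacing \<open>j'\<close> by \<open>j' + n b\<close> shifts the first
      coordinate by \<open>-2 n b\<close>, a multiple of \<open>2 m\<close>. Expanding the quadratic
      term gives the cofactor of \<open>n\<close> in the second.\<close>
    assume "g = Sigma1" "r"
    then show ?thesis unfolding l st a b
      by (simp, intro pair_congI[of _ _ a 0 "- b" _ _ "d * b * (2 * j' + n * b + 1) - b" 0 0 0])
        (simp_all add: algebra_simps)
  next
    assume "g = Sigma1" "\<not> r"
    then show ?thesis unfolding l st a b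
      by (simp, intro pair_congI[of _ _ a 0 "- b" _ _ "d * b * (2 * j' + n * b - 1) - b" 0 0 0])
        (simp_all add: algebra_simps)
  qed (simp_all add: l st a b pcong_def)
qed

lemma fold_act_cong: "s \<approx> t \<Longrightarrow> fold (act d) w s \<approx> fold (act d) w t"
  by (induction w arbitrary: s t) (simp_all add: act_cong)

text \<open>For \<open>Sigma1\<close> the terms linear in \<open>d\<close> cancel in the second
  coordinate and the rest carries \<open>d^2\<close>; the first coordinate changes by a multiple of
  \<open>2 d\<close>.\<close>

lemma act_cancel: "act d (s, \<not> b) (act d (s, b) u) \<approx> u"
proof -
  obtain i j where u: "u = (i, j)" by fastforce
  show ?thesis
  proof (cases s; cases b)
    assume "s = Sigma1" "b"
    then show ?thesis unfolding u
      by (simp, intro pair_congI[of _ _ 0 "- (j * (j + 1))" 0 _ _ 0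
            "(j * (j + 1)) * (d * (j * (j + 1)) - 2 * j - 1)" 0 0])
        (simp_all add: algebra_simps)
  next
    assume "s = Sigma1" "\<not> b"
    then show ?thesis unfolding u
      by (simp, intro pair_congI[of _ _ 0 "- (j * (j - 1))" 0 _ _ 0
            "(j * (j - 1)) * (d * (j * (j - 1)) - 2 * j + 1)" 0 0])
        (simp_all add: algebra_simps)
  qed (simp_all add: u pcong_def)
qed

text \<open>The quadratic terms of the two steps combine to \<open>2 d j\<close> modulo
  \<open>d^2\<close>. So \<open>x^2\<close> conjugates \<open>y\<close> to
  \<open>y^(1 + 2 d)\<close>, where \<open>2 d\<close> is \<open>c\<close> modulo
  \<open>n\<close>.\<close>

lemma act_square:
  "act d (Sigma1, False) (act d (Sigma1, False) (i, j)) \<approx> (i + 2, j + 2 * d * j)"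
  by (simp, intro pair_congI[of _ _ 0 "- (j * (j - 1))" 0 _ _ 0
        "(j * (j - 1)) * (d * (j * (j - 1)) - 2 * j - 1)" 0 0])
    (simp_all add: algebra_simps)

lemma act_square_inv:
  "act d (Sigma1, True) (act d (Sigma1, True) (i, j)) \<approx> (i - 2, j - 2 * d * j)"
  by (simp, intro pair_congI[of _ _ 0 "- (j * (j + 1))" 0 _ _ 0
        "(j * (j + 1)) * (d * (j * (j + 1)) - 2 * j + 1)" 0 0])
    (simp_all add: algebra_simps)

lemmas pair_cong_trans = equivp_transp[OF equivp_pcong] and pair_cong_sym = equivp_symp[OF equivp_pcong]
  and pair_cong_refl = equivp_reflp[OF equivp_pcong]

text \<open>Each double step multiplies the second coordinate by \<open>1 + 2 d\<close>, and
  \<open>(1 + 2 d)^a\<close> is \<open>1 + 2 a d\<close> because \<open>d^2\<close> vanishes modulo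
  \<open>n\<close>.\<close>

lemma act_even_power:
  "fold (act d) (replicate (2 * a) (Sigma1, False)) (i, j) \<approx> (i + 2 * int a, j + 2 * int a * d * j)"
proof (induction a)
  case 0
  show ?case by (simp add: pair_cong_refl)
next
  case (Suc a)
  let ?A = "act d (Sigma1, False)"
  have "replicate (2 * Suc a) (Sigma1, False)
      = replicate (2 * a) (Sigma1, False) @ [(Sigma1, False), (Sigma1, False)]"
    by (simp add: replicate_app_Cons_same)
  then have "fold (act d) (replicate (2 * Suc a) (Sigma1, False)) (i, j)
      = ?A (?A (fold (act d) (replicate (2 * a) (Sigma1, False)) (i, j)))" by simp
  also have "\<dots> \<approx> ?A (?A (i + 2 * int a, j + 2 * int a * d * j))"
    by (intro act_cong Suc)
  finally have "fold (act d) (replicate (2 * Suc a) (Sigma1, False)) (i, j)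
      \<approx> ?A (?A (i + 2 * int a, j + 2 * int a * d * j))" .
  moreover have "?A (?A (i + 2 * int a, j + 2 * int a * d * j))
      \<approx> (i + 2 * int a + 2, j + 2 * int a * d * j + 2 * d * (j + 2 * int a * d * j))"
    by (rule act_square)
  moreover have "(i + 2 * int a + 2, j + 2 * int a * d * j + 2 * d * (j + 2 * int a * d * j))
      \<approx> (i + 2 * int (Suc a), j + 2 * int (Suc a) * d * j)"
    by (rule pair_congI[of _ _ 0 0 0 _ _ 0 "4 * int a * j" 0 0]) (simp_all add: algebra_simps)
  ultimately show ?case by (meson pair_cong_trans)
qed

lemma act_relation:
  assumes "m > 0" "n > 0" "(l, r) \<in> Gamma_rels (2 * m) n 3 (1 + c) (-3) (-1 + c)"
  shows "fold (act d) l s \<approx> fold (act d) r s"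
proof -
  obtain i j where s: "s = (i, j)" by fastforce
  have pow: "gen_power Sigma1 3 = [(Sigma1, False), (Sigma1, False), (Sigma1, False)]"
    "gen_power Sigma1 (-3) = [(Sigma1, True), (Sigma1, True), (Sigma1, True)]"
    "gen_power g 1 = [(g, False)]" "gen_power g (-1) = [(g, True)]" for g :: sigma
    by (simp_all add: gen_power_def numeral_eq_Suc)
  consider "(l, r) = (gen_power Sigma1 (2 * m), [])"
    | "(l, r) = (gen_power Sigma2 n, [])"
    | "(l, r) = ([(Sigma1, False), (Sigma2, False), (Sigma1, False), (Sigma2, False)], [])"
    | "(l, r) = ([(Sigma2, True), (Sigma1, False)],
        [(Sigma1, False), (Sigma1, False)] @ (Sigma1, False) # gen_power Sigma2 (1 + c))"
    | "(l, r) = ([(Sigma2, False), (Sigma1, True)],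
        [(Sigma1, True), (Sigma1, True)] @ (Sigma1, True) # gen_power Sigma2 (-1 + c))"
    using assms(3) unfolding Gamma_rels_def pow by auto
  then show ?thesis
  proof cases
    case 1
    have "gen_power Sigma1 (2 * m) = replicate (2 * nat m) (Sigma1, False)"
      using assms(1) by (simp add: gen_power_def nat_mult_distrib)
    \<comment> \<open>The term \<open>2 m d j\<close> vanishes because \<open>n\<close> divides
      \<open>m d\<close>.\<close>
    moreover have "(i + 2 * m, j + 2 * m * d * j) \<approx> (i, j)"
      by (rule pair_congI[of _ _ 1 0 0 _ _ 0 0 0 "2 * j"]) (simp_all add: algebra_simps)
    ultimately show ?thesis
      using pair_cong_trans[OF act_even_power[of "nat m" i j]] assms(1) 1 s by simp
  next
    case 2
    then show ?thesis by (simp add: s fold_gen_power_Sigma2 pcong_def)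
  next
    case 3
    then show ?thesis unfolding s
      by (simp, intro pair_congI[of _ _ 0 "- (j * (j - 1))" 0 _ _ 0
            "(j * (j - 1)) * (d * (j * (j - 1)) - 2 * j + 1)" 0 0])
        (simp_all add: algebra_simps)
  next
    case 4
    \<comment> \<open>Splitting \<open>x^3\<close> as \<open>x^2 x\<close> lets
      \<open>act_square\<close> absorb the first two letters. In the second coordinate of what
      remains, the terms linear in \<open>d\<close> and the exponent \<open>c\<close> add up to
      \<open>2 d - c\<close>. The fifth relation works the same way.\<close>
    let ?w = "(Sigma1, False) # gen_power Sigma2 (1 + c)"
    have "fold (act d) ?w (act d (Sigma1, False) (act d (Sigma1, False) (i, j)))
        \<approx> fold (act d) ?w (i + 2, j + 2 * d * j)"
      by (rule fold_act_cong[OF act_square])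
    moreover have "fold (act d) l s \<approx> fold (act d) ?w (i + 2, j + 2 * d * j)"
      using 4 unfolding s
      by (simp add: fold_gen_power_Sigma2, intro pair_congI[of _ _ 0 "2 * j" 0 _ _ 0
            "- (4 * j * j - 2 * j + 4 * d * j * j)" 1 0])
        (simp_all add: algebra_simps)
    ultimately show ?thesis using 4 s by (auto intro: pair_cong_trans pair_cong_sym)
  next
    case 5
    let ?w = "(Sigma1, True) # gen_power Sigma2 (-1 + c)"
    have "fold (act d) ?w (act d (Sigma1, True) (act d (Sigma1, True) (i, j)))
        \<approx> fold (act d) ?w (i - 2, j - 2 * d * j)"
      by (rule fold_act_cong[OF act_square_inv])
    moreover have "fold (act d) l s \<approx> fold (act d) ?w (i - 2, j - 2 * d * j)"
      using 5 unfolding s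
      by (simp add: fold_gen_power_Sigma2, intro pair_congI[of _ _ 0 "- 2 * j" 0 _ _ 0
            "- (4 * d * j * j - 4 * j * j - 2 * j)" 1 0])
        (simp_all add: algebra_simps)
    ultimately show ?thesis using 5 s by (auto intro: pair_cong_trans pair_cong_sym)
  qed
qed

lemma word_eq_act:
  assumes "m > 0" "n > 0" "word_eq (Gamma_rels (2 * m) n 3 (1 + c) (-3) (-1 + c)) v w"
  shows "fold (act d) v s \<approx> fold (act d) w s"
  by (rule word_eq_fold[OF equivp_pcong act_cong act_cancel act_relation[OF assms(1,2)] assms(3)])

text \<open>From \<open>(0, 0)\<close> the two words lead to \<open>(i, 0)\<close> and
  \<open>(0, j)\<close>, so equal powers force both pairs to vanish.\<close>

lemma gen_powers_eq:
  assumes "m > 0" "n > 0"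
    and "word_eq (Gamma_rels (2 * m) n 3 (1 + c) (-3) (-1 + c)) (gen_power Sigma1 i) (gen_power Sigma2 j)"
  shows "2 * m dvd i" "n dvd j"
  using word_eq_act[OF assms, of "(0, 0)"]
  by (simp_all add: fold_gen_power_Sigma1_zero fold_gen_power_Sigma2 pcong_def)

end

text \<open>The products \<open>x^i y^j\<close> are closed under right multiplication by the
  generators and their inverses once powers of \<open>y\<close> can be moved past \<open>x\<close>.
  This rests on \<open>y x = x x^(-2) inv y\<close> and on \<open>yx2\<close>, which moves powers of
  \<open>y\<close> past \<open>x^(-2)\<close>.\<close>

lemma (in group) product_of_cyclic:
  assumes [simp]: "x \<in> carrier G" "y \<in> carrier G" and gen: "generate G {x, y} = carrier G"
    and N: "N > 0" "y [^] (N :: int) = \<one>"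
    and yx: "y \<otimes> x = inv x \<otimes> inv y"
    and yx2: "inv y \<otimes> x [^] (-2 :: int) = x [^] (-2 :: int) \<otimes> y [^] (e :: int)"
    and g: "g \<in> carrier G"
  shows "\<exists>(i :: int) (j :: int). g = x [^] i \<otimes> y [^] j"
proof -
  let ?u = "x [^] (-2 :: int)"
  have nonneg: "\<exists>k :: nat. y [^] j = y [^] int k" for j :: int
  proof
    \<comment> \<open>Since \<open>N\<close> is at least 1, this shift by a multiple of
      \<open>N\<close> makes the exponent nonnegative without changing the power.\<close>
    have "j + N * \<bar>j\<bar> \<ge> 0" using N(1) mult_mono[of 1 N "\<bar>j\<bar>" "\<bar>j\<bar>"] by simp
    moreover have "y [^] (j + N * \<bar>j\<bar>) = y [^] j"
      using N(2) by (simp add: int_pow_mult int_pow_pow[symmetric])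
    ultimately show "y [^] j = y [^] int (nat (j + N * \<bar>j\<bar>))" by simp
  qed
  have u: "\<exists>b :: int. y [^] j \<otimes> ?u = ?u \<otimes> y [^] b" for j :: int
  proof -
    \<comment> \<open>\<open>yx2\<close> moves \<open>inv y\<close>, so the induction runs over
      negative powers; \<open>nonneg\<close> for \<open>- j\<close> writes any power of
      \<open>y\<close> as one of these.\<close>
    have "y [^] (- int k) \<otimes> ?u = ?u \<otimes> y [^] (e * int k)" for k
    proof (induction k)
      case (Suc k)
      have "y [^] (- int (Suc k)) \<otimes> ?u = y [^] (- int k) \<otimes> (y [^] (-1 :: int) \<otimes> ?u)"
      proof -
        have "- int (Suc k) = - int k + (-1)" by simp
        then show ?thesis by (simp only: int_pow_mult int_pow_closed m_assoc assms(1,2))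
      qed
      also have "\<dots> = y [^] (- int k) \<otimes> ?u \<otimes> y [^] e"
        using yx2 by (simp add: int_pow_neg m_assoc)
      also have "\<dots> = ?u \<otimes> y [^] (e * int (Suc k))"
        unfolding Suc by (simp add: m_assoc int_pow_mult[symmetric] algebra_simps)
      finally show ?case .
    qed simp
    moreover obtain k where "y [^] (- j) = y [^] int k" using nonneg by blast
    then have "y [^] j = y [^] (- int k)" by (metis int_pow_neg assms(2) minus_minus)
    ultimately show ?thesis by metis
  qed
  have x: "\<exists>(a :: int) (b :: int). y [^] j \<otimes> x = x [^] a \<otimes> y [^] b" for j :: int
  proof -
    have "\<exists>(a :: int) (b :: int). y [^] int k \<otimes> x = x [^] a \<otimes> y [^] b" for k
    proof (induction k)
      case 0
      have "y [^] int 0 \<otimes> x = x [^] (1 :: int) \<otimes> y [^] (0 :: int)" by simp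
      then show ?case by blast
    next
      case (Suc k)
      then obtain a b :: int where ab: "y [^] int k \<otimes> x = x [^] a \<otimes> y [^] b" by blast
      obtain b' :: int where b': "y [^] b \<otimes> ?u = ?u \<otimes> y [^] b'" using u by blast
      \<comment> \<open>This turns \<open>y x\<close> into \<open>x x^(-2) inv y\<close>: the
        induction hypothesis moves \<open>x\<close> past \<open>y^k\<close>, and the claim
        \<open>u\<close> then takes care of \<open>x^(-2)\<close>.\<close>
      have inv_x: "inv x = x \<otimes> ?u"
        using int_pow_mult[of x 1 "-2"] by (simp add: int_pow_neg)
      have "y [^] int (Suc k) \<otimes> x = y [^] int k \<otimes> (y \<otimes> x)"
        using int_pow_mult[of y "int k" 1] by (simp add: m_assoc add.commute)
      also have "\<dots> = y [^] int k \<otimes> x \<otimes> ?u \<otimes> inv y"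
        unfolding yx inv_x by (simp add: m_assoc)
      also have "\<dots> = x [^] a \<otimes> (y [^] b \<otimes> ?u) \<otimes> inv y"
        unfolding ab by (simp add: m_assoc)
      also have "\<dots> = x [^] (a + -2) \<otimes> y [^] (b' + -1)"
        unfolding b' int_pow_mult[OF assms(1)] int_pow_mult[OF assms(2)] by (simp add: m_assoc int_pow_neg)
      finally show ?case by blast
    qed
    then show ?thesis using nonneg[of j] by metis
  qed
  have mult_x: "\<exists>(i' :: int) (j' :: int). x [^] i \<otimes> y [^] j \<otimes> x = x [^] i' \<otimes> y [^] j'" for i j :: int
  proof -
    obtain a b :: int where "y [^] j \<otimes> x = x [^] a \<otimes> y [^] b" using x by blast
    then have "x [^] i \<otimes> y [^] j \<otimes> x = x [^] (i + a) \<otimes> y [^] b"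
      by (simp add: m_assoc int_pow_mult)
    then show ?thesis by blast
  qed
  \<comment> \<open>Right multiplication by \<open>inv x\<close> will be carried out as
    \<open>x\<close> followed by \<open>x^(-2)\<close>.\<close>
  have mult_u: "\<exists>(i' :: int) (j' :: int). x [^] i \<otimes> y [^] j \<otimes> ?u = x [^] i' \<otimes> y [^] j'" for i j :: int
  proof -
    obtain b :: int where "y [^] j \<otimes> ?u = ?u \<otimes> y [^] b" using u by blast
    then have "x [^] i \<otimes> y [^] j \<otimes> ?u = x [^] (i + -2) \<otimes> y [^] b"
      unfolding int_pow_mult[OF assms(1)] by (simp add: m_assoc)
    then show ?thesis by blast
  qed
  have "\<exists>(i' :: int) (j' :: int). x [^] i \<otimes> y [^] j \<otimes> h = x [^] i' \<otimes> y [^] j'" if "h \<in> generate G {x, y}"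
    for h and i j :: int
    using that
  proof (induction arbitrary: i j)
    case one
    then show ?case by auto
  next
    case (incl h)
    have "x [^] i \<otimes> y [^] j \<otimes> y = x [^] i \<otimes> y [^] (j + 1)" by (simp add: m_assoc int_pow_mult)
    then show ?case using incl mult_x by blast
  next
    case (inv h)
    have "x [^] i \<otimes> y [^] j \<otimes> inv y = x [^] i \<otimes> y [^] (j + -1)"
      unfolding int_pow_mult[OF assms(2)] by (simp add: m_assoc int_pow_neg)
    moreover have "\<exists>(i' :: int) (j' :: int). x [^] i \<otimes> y [^] j \<otimes> inv x = x [^] i' \<otimes> y [^] j'"
    proof -
      have "inv x = x \<otimes> ?u" using int_pow_mult[of x 1 "-2"] by (simp add: int_pow_neg)
      then have "x [^] i \<otimes> y [^] j \<otimes> inv x = x [^] i \<otimes> y [^] j \<otimes> x \<otimes> ?u" by (simp add: m_assoc)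
      then show ?thesis using mult_x[of i j] mult_u by metis
    qed
    ultimately show ?case using inv by blast
  next
    case (eng h1 h2)
    then have "h1 \<in> carrier G" "h2 \<in> carrier G" by (auto simp: gen)
    then have "x [^] i \<otimes> y [^] j \<otimes> (h1 \<otimes> h2) = x [^] i \<otimes> y [^] j \<otimes> h1 \<otimes> h2" by (simp add: m_assoc)
    then show ?case using eng.IH by metis
  qed
  from this[of g 0 0] g gen show ?thesis by simp
qed

theorem theorem3p6:
  fixes m \<beta> :: nat and k :: int
  assumes "prime m" and "odd m" and "\<beta> \<ge> 2" and "1 \<le> k" and "k \<le> int m - 1"
  shows "\<exists>P :: nat ranked_poset.
    chiral P \<and> has_type P (2 * m) (m ^ \<beta>) \<and> tight P (2 * m) (m ^ \<beta>) \<and>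
    Gamma_is_aut_group_of (int (2 * m)) (int (m ^ \<beta>))
      3 (1 + k * int m ^ (\<beta> - 1)) (-3) (-1 + k * int m ^ (\<beta> - 1)) P"
proof -
  define M where "M = int m"
  define n where "n = M ^ \<beta>"
  define c where "c = k * M ^ (\<beta> - 1)"
  \<comment> \<open>\<open>h\<close> is the inverse of 2 modulo the odd number \<open>M\<close>. As
    \<open>M c\<close> is a multiple of \<open>n\<close>, the choice \<open>d = c h\<close> gives
    \<open>2 d = c (M + 1)\<close>, which is \<open>c\<close> modulo \<open>n\<close>.\<close>
  define h where "h = (M + 1) div 2"
  define d where "d = c * h"
  define R where "R = Gamma_rels (2 * M) n 3 (1 + c) (-3) (-1 + c)"
  define x where "x = presented_gen R Sigma1"
  define y where "y = presented_gen R Sigma2"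
  let ?G = "presented_group R"
  have M: "M > 1" using assms(1) prime_gt_1_nat by (simp add: M_def)
  have n: "n > 0" using M by (simp add: n_def)
  have h: "2 * h = M + 1" using assms(2) by (auto simp: h_def M_def elim!: oddE)
  \<comment> \<open>Because \<open>\<beta> \<ge> 2\<close>, the square of
    \<open>M^(\<beta> - 1)\<close> is a multiple of \<open>M^\<beta>\<close>, so \<open>n\<close>
    divides \<open>d^2\<close>. Writing \<open>\<beta>\<close> as \<open>r + 2\<close> makes the
    cofactors explicit.\<close>
  obtain r where \<beta>: "\<beta> = Suc (Suc r)" using assms(3) by (metis One_nat_def Suc_1 Suc_le_D Suc_le_mono)
  have nc: "n = M * M * M ^ r" "c = k * M * M ^ r" by (simp_all add: n_def c_def \<beta>)
  have "2 * d - c = n * k"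
  proof -
    have "2 * d - c = c * (2 * h) - c" by (simp add: d_def)
    then show ?thesis unfolding h by (simp add: nc algebra_simps)
  qed
  moreover have "M * d = n * (k * h)" "d * d = n * (k * k * h * h * M ^ r)" "d = M * (k * M ^ r * h)" "n = M * (M * M ^ r)"
    by (simp_all add: d_def nc algebra_simps)
  ultimately interpret params: gamma_params M n d c
    by unfold_locales (metis dvd_triv_left)+
  interpret G: group ?G by (rule group_presented_group)
  have xy [simp]: "x \<in> carrier ?G" "y \<in> carrier ?G" by (simp_all add: x_def y_def)
  \<comment> \<open>The action on pairs enters here; this fact gives the lower bounds for the orders
    of \<open>x\<close> and \<open>y\<close>, the uniqueness of the normal form and the trivial
    intersection.\<close>
  have powers: "2 * M dvd i" "n dvd j" if "x [^]\<^bsub>?G\<^esub> i = y [^]\<^bsub>?G\<^esub> j" for i j :: int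
  proof -
    have "word_eq R (gen_power Sigma1 i) (gen_power Sigma2 j)"
      using that by (simp add: x_def y_def word_class_gen_power[symmetric] word_class_eq_iff)
    then show "2 * M dvd i" "n dvd j" using params.gen_powers_eq[of i j] M n by (auto simp only: R_def)
  qed
  have rel: "word_class R l = word_class R r" if "(l, r) \<in> R" for l r
    using word_eq.relation[OF that, of "[]" "[]"] by (simp add: word_class_eq_iff)
  have rel1: "x [^]\<^bsub>?G\<^esub> (2 * M) = \<one>\<^bsub>?G\<^esub>"
    using rel[of "gen_power Sigma1 (2 * M)" "[]"]
    by (simp add: R_def Gamma_rels_def word_class_gen_power presented_one x_def)
  have rel2: "y [^]\<^bsub>?G\<^esub> n = \<one>\<^bsub>?G\<^esub>"
    using rel[of "gen_power Sigma2 n" "[]"]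
    by (simp add: R_def Gamma_rels_def word_class_gen_power presented_one y_def)
  note gen_power_mult = presented_group_mult[symmetric] word_class_gen_power x_def[symmetric] y_def[symmetric]
  have rel3: "x \<otimes>\<^bsub>?G\<^esub> (y \<otimes>\<^bsub>?G\<^esub> (x \<otimes>\<^bsub>?G\<^esub> y)) = \<one>\<^bsub>?G\<^esub>"
  proof -
    have "word_class R (gen_power Sigma1 1 @ gen_power Sigma2 1 @ gen_power Sigma1 1 @ gen_power Sigma2 1) = word_class R []"
      by (rule rel) (simp add: R_def Gamma_rels_def)
    then show ?thesis by (simp add: gen_power_mult presented_one)
  qed
  have rel4: "inv\<^bsub>?G\<^esub> y \<otimes>\<^bsub>?G\<^esub> x = x [^]\<^bsub>?G\<^esub> (3 :: int) \<otimes>\<^bsub>?G\<^esub> y [^]\<^bsub>?G\<^esub> (1 + c)"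
  proof -
    have "word_class R (gen_power Sigma2 (-1) @ gen_power Sigma1 1) = word_class R (gen_power Sigma1 3 @ gen_power Sigma2 (1 + c))"
      by (rule rel) (simp add: R_def Gamma_rels_def)
    then show ?thesis by (simp add: gen_power_mult G.int_pow_neg)
  qed
  have rel5: "y \<otimes>\<^bsub>?G\<^esub> inv\<^bsub>?G\<^esub> x = x [^]\<^bsub>?G\<^esub> (-3 :: int) \<otimes>\<^bsub>?G\<^esub> y [^]\<^bsub>?G\<^esub> (-1 + c)"
  proof -
    have "word_class R (gen_power Sigma2 1 @ gen_power Sigma1 (-1)) = word_class R (gen_power Sigma1 (-3) @ gen_power Sigma2 (-1 + c))"
      by (rule rel) (simp add: R_def Gamma_rels_def)
    then show ?thesis by (simp add: gen_power_mult G.int_pow_neg)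
  qed
  have generated: "generate ?G {x, y} = carrier ?G"
  proof -
    have UNIV_sigma: "UNIV = {Sigma1, Sigma2}" using sigma.exhaust by auto
    have "range (presented_gen R) = {x, y}" unfolding UNIV_sigma x_def y_def by simp
    then show ?thesis using presented_generated[of R] by simp
  qed
  have yx: "y \<otimes>\<^bsub>?G\<^esub> x = inv\<^bsub>?G\<^esub> x \<otimes>\<^bsub>?G\<^esub> inv\<^bsub>?G\<^esub> y"
  proof -
    have "inv\<^bsub>?G\<^esub> x = y \<otimes>\<^bsub>?G\<^esub> (x \<otimes>\<^bsub>?G\<^esub> y)"
      using G.inv_equality[OF rel3] by (metis G.inv_inv G.m_closed xy)
    then show ?thesis by (simp add: G.m_assoc)
  qed
  have xy_inv: "x \<otimes>\<^bsub>?G\<^esub> y = inv\<^bsub>?G\<^esub> y \<otimes>\<^bsub>?G\<^esub> inv\<^bsub>?G\<^esub> x"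
    using rel3 by (metis G.inv_mult_group G.inv_equality G.m_assoc G.m_closed xy)
  \<comment> \<open>Since \<open>inv y inv x = x y\<close>, the left side is
    \<open>x (y inv x)\<close>, and the fifth relation rewrites the bracket.\<close>
  have yx2: "inv\<^bsub>?G\<^esub> y \<otimes>\<^bsub>?G\<^esub> x [^]\<^bsub>?G\<^esub> (-2 :: int) = x [^]\<^bsub>?G\<^esub> (-2 :: int) \<otimes>\<^bsub>?G\<^esub> y [^]\<^bsub>?G\<^esub> (-1 + c)"
  proof -
    have "inv\<^bsub>?G\<^esub> y \<otimes>\<^bsub>?G\<^esub> x [^]\<^bsub>?G\<^esub> (-2 :: int) = x \<otimes>\<^bsub>?G\<^esub> y \<otimes>\<^bsub>?G\<^esub> inv\<^bsub>?G\<^esub> x"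
      using G.int_pow_mult[of x "-1" "-1"] by (simp add: xy_inv G.m_assoc G.int_pow_neg)
    also have "\<dots> = x \<otimes>\<^bsub>?G\<^esub> x [^]\<^bsub>?G\<^esub> (-3 :: int) \<otimes>\<^bsub>?G\<^esub> y [^]\<^bsub>?G\<^esub> (-1 + c)"
      using rel5 by (simp add: G.m_assoc)
    also have "x \<otimes>\<^bsub>?G\<^esub> x [^]\<^bsub>?G\<^esub> (-3 :: int) = x [^]\<^bsub>?G\<^esub> (-2 :: int)"
      using G.int_pow_mult[of x 1 "-3"] by simp
    finally show ?thesis .
  qed
  have normal_form: "\<exists>(i :: int) (j :: int). g = x [^]\<^bsub>?G\<^esub> i \<otimes>\<^bsub>?G\<^esub> y [^]\<^bsub>?G\<^esub> j" if "g \<in> carrier ?G" for g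
    by (rule G.product_of_cyclic[OF xy generated n rel2 yx yx2 that])
  have ord_x: "int (G.ord x) = 2 * M"
  proof (rule zdvd_antisym_nonneg)
    show "int (G.ord x) dvd 2 * M" using rel1 G.int_pow_eq_id by simp
    show "2 * M dvd int (G.ord x)"
      using powers(1)[of "int (G.ord x)" 0] G.int_pow_eq_id[of x "int (G.ord x)"] by simp
  qed (use M in simp_all)
  have ord_y: "int (G.ord y) = n"
  proof (rule zdvd_antisym_nonneg)
    show "int (G.ord y) dvd n" using rel2 G.int_pow_eq_id by simp
    show "n dvd int (G.ord y)"
      using powers(2)[of 0 "int (G.ord y)"] G.int_pow_eq_id[of y "int (G.ord y)"] by simp
  qed (use n in simp_all)
  have bij: "bij_betw (\<lambda>(i, j). x [^]\<^bsub>?G\<^esub> i \<otimes>\<^bsub>?G\<^esub> y [^]\<^bsub>?G\<^esub> j) ({0..<2 * M} \<times> {0..<n}) (carrier ?G)"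
    unfolding bij_betw_def
  proof
    show "inj_on (\<lambda>(i, j). x [^]\<^bsub>?G\<^esub> i \<otimes>\<^bsub>?G\<^esub> y [^]\<^bsub>?G\<^esub> j) ({0..<2 * M} \<times> {0..<n})"
    proof (rule inj_onI, clarify)
      fix i j i' j' :: int
      assume range: "i \<in> {0..<2 * M}" "j \<in> {0..<n}" "i' \<in> {0..<2 * M}" "j' \<in> {0..<n}"
        and eq: "x [^]\<^bsub>?G\<^esub> i \<otimes>\<^bsub>?G\<^esub> y [^]\<^bsub>?G\<^esub> j = x [^]\<^bsub>?G\<^esub> i' \<otimes>\<^bsub>?G\<^esub> y [^]\<^bsub>?G\<^esub> j'"
      \<comment> \<open>Cancelling \<open>x^i'\<close> on the left and \<open>y^j\<close> on the
        right separates the generators, so that \<open>powers\<close> applies.\<close>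
      have "x [^]\<^bsub>?G\<^esub> (- i' + i) = y [^]\<^bsub>?G\<^esub> (j' + - j)"
      proof -
        have "inv\<^bsub>?G\<^esub> (x [^]\<^bsub>?G\<^esub> i') \<otimes>\<^bsub>?G\<^esub> (x [^]\<^bsub>?G\<^esub> i \<otimes>\<^bsub>?G\<^esub> y [^]\<^bsub>?G\<^esub> j) \<otimes>\<^bsub>?G\<^esub> inv\<^bsub>?G\<^esub> (y [^]\<^bsub>?G\<^esub> j)
            = inv\<^bsub>?G\<^esub> (x [^]\<^bsub>?G\<^esub> i') \<otimes>\<^bsub>?G\<^esub> (x [^]\<^bsub>?G\<^esub> i' \<otimes>\<^bsub>?G\<^esub> y [^]\<^bsub>?G\<^esub> j') \<otimes>\<^bsub>?G\<^esub> inv\<^bsub>?G\<^esub> (y [^]\<^bsub>?G\<^esub> j)"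
          by (simp only: eq)
        then have "inv\<^bsub>?G\<^esub> (x [^]\<^bsub>?G\<^esub> i') \<otimes>\<^bsub>?G\<^esub> x [^]\<^bsub>?G\<^esub> i = y [^]\<^bsub>?G\<^esub> j' \<otimes>\<^bsub>?G\<^esub> inv\<^bsub>?G\<^esub> (y [^]\<^bsub>?G\<^esub> j)"
          by (simp add: G.m_assoc) (simp add: G.m_assoc[symmetric])
        then show ?thesis
          unfolding G.int_pow_mult[OF xy(1)] G.int_pow_mult[OF xy(2)] by (simp add: G.int_pow_neg)
      qed
      then have dvd: "2 * M dvd i - i'" "n dvd j' - j" using powers by force+
      have "i mod (2 * M) = i' mod (2 * M)" "j' mod n = j mod n"
        using dvd by (simp_all only: mod_eq_dvd_iff)
      then show "i = i' \<and> j = j'" using range by simp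
    qed
    show "(\<lambda>(i, j). x [^]\<^bsub>?G\<^esub> i \<otimes>\<^bsub>?G\<^esub> y [^]\<^bsub>?G\<^esub> j) ` ({0..<2 * M} \<times> {0..<n}) = carrier ?G" (is "?l = _")
    proof
      show "carrier ?G \<subseteq> ?l"
      proof
        fix g assume "g \<in> carrier ?G"
        then obtain i j :: int where "g = x [^]\<^bsub>?G\<^esub> i \<otimes>\<^bsub>?G\<^esub> y [^]\<^bsub>?G\<^esub> j" using normal_form by blast
        moreover have "x [^]\<^bsub>?G\<^esub> i = x [^]\<^bsub>?G\<^esub> (i mod (2 * M))" "y [^]\<^bsub>?G\<^esub> j = y [^]\<^bsub>?G\<^esub> (j mod n)"
          by (simp_all add: G.int_pow_eq ord_x ord_y mod_eq_dvd_iff[symmetric])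
        ultimately have "g = (\<lambda>(i, j). x [^]\<^bsub>?G\<^esub> i \<otimes>\<^bsub>?G\<^esub> y [^]\<^bsub>?G\<^esub> j) (i mod (2 * M), j mod n)" by simp
        then show "g \<in> ?l" by (rule image_eqI) (use M n in simp)
      qed
    qed auto
  qed
  have finite: "finite (carrier ?G)" using bij bij_betw_finite by blast
  have order: "card (carrier ?G) = 2 * m * m ^ \<beta>"
    using bij_betw_same_card[OF bij] M by (simp add: card_cartesian_product n_def M_def nat_mult_distrib nat_power_eq)
  interpret rotation_group ?G x y
  proof
    show "x \<otimes>\<^bsub>?G\<^esub> y \<otimes>\<^bsub>?G\<^esub> (x \<otimes>\<^bsub>?G\<^esub> y) = \<one>\<^bsub>?G\<^esub>" using rel3 by (simp add: G.m_assoc)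
    show "generate ?G {x} \<inter> generate ?G {y} = {\<one>\<^bsub>?G\<^esub>}"
    proof (intro equalityI subsetI)
      fix g assume "g \<in> generate ?G {x} \<inter> generate ?G {y}"
      then obtain i j :: int where g: "g = x [^]\<^bsub>?G\<^esub> i" "g = y [^]\<^bsub>?G\<^esub> j"
        by (auto simp: G.generate_pow)
      then have "2 * M dvd i" using powers(1)[of i j] by simp
      then show "g \<in> {\<one>\<^bsub>?G\<^esub>}" using g(1) G.int_pow_eq_id[of x i] by (simp add: ord_x)
    qed (auto intro: generate.one)
    show "x \<noteq> \<one>\<^bsub>?G\<^esub>" using powers(1)[of 1 0] M zdvd_imp_le[of "2 * M" 1] by auto
    show "y \<noteq> \<one>\<^bsub>?G\<^esub>"
    proof
      assume "y = \<one>\<^bsub>?G\<^esub>"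
      then have "n dvd 1" using powers(2)[of 0 1] by simp
      then have "M dvd 1" using params.m_n dvd_trans by blast
      then show False using M by simp
    qed
  qed (use finite generated in simp_all)
  have no_reflection: "\<not> (\<exists>\<rho>\<in>hom ?G ?G. \<rho> x = inv\<^bsub>?G\<^esub> x \<and> \<rho> y = inv\<^bsub>?G\<^esub> y)"
  proof
    assume "\<exists>\<rho>\<in>hom ?G ?G. \<rho> x = inv\<^bsub>?G\<^esub> x \<and> \<rho> y = inv\<^bsub>?G\<^esub> y"
    then obtain \<rho> where \<rho>: "\<rho> \<in> hom ?G ?G" "\<rho> x = inv\<^bsub>?G\<^esub> x" "\<rho> y = inv\<^bsub>?G\<^esub> y" by blast
    interpret \<rho>: group_hom ?G ?G \<rho> by unfold_locales (rule \<rho>(1))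
    \<comment> \<open>The image of the fourth relation has the same left side and the same power of
      \<open>x\<close> as the fifth, so only powers of \<open>y\<close> remain to be
      compared.\<close>
    have "\<rho> (inv\<^bsub>?G\<^esub> y \<otimes>\<^bsub>?G\<^esub> x) = \<rho> (x [^]\<^bsub>?G\<^esub> (3 :: int) \<otimes>\<^bsub>?G\<^esub> y [^]\<^bsub>?G\<^esub> (1 + c))" by (simp only: rel4)
    then have "y \<otimes>\<^bsub>?G\<^esub> inv\<^bsub>?G\<^esub> x = x [^]\<^bsub>?G\<^esub> (-3 :: int) \<otimes>\<^bsub>?G\<^esub> y [^]\<^bsub>?G\<^esub> (- (1 + c))"
      by (simp only: \<rho>.hom_mult \<rho>.hom_inv \<rho>.hom_int_pow \<rho>(2,3) G.int_pow_inv G.int_pow_neg G.inv_inv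
          xy G.inv_closed G.int_pow_closed)
    then have "y [^]\<^bsub>?G\<^esub> (- (1 + c)) = y [^]\<^bsub>?G\<^esub> (-1 + c)"
      unfolding rel5 by (simp del: minus_add_distrib)
    then have "n dvd 2 * c" by (simp add: G.int_pow_eq ord_y)
    \<comment> \<open>The common factor \<open>M M^r\<close> of \<open>n\<close> and
      \<open>c\<close> is cancelled.\<close>
    then have "M dvd 2 * k" using M by (simp add: nc)
    \<comment> \<open>As \<open>2 h - M = 1\<close>, this combination removes the factor 2 and
      leaves \<open>k\<close>, which lies strictly between 0 and \<open>M\<close>.\<close>
    then have "M dvd h * (2 * k) - M * k" by simp
    moreover have "h * (2 * k) - M * k = k" using h by (metis add_diff_cancel_left' distrib_right mult.assoc mult.commute mult_1)
    ultimately have "M dvd k" by simp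
    then show False using zdvd_imp_le[of M k] assms(4,5) by (simp add: M_def)
  qed
  have "G.ord x = 2 * m" "G.ord y = m ^ \<beta>"
    using ord_x ord_y by (simp_all add: n_def M_def flip: of_nat_power)
  then have "has_type P (2 * m) (m ^ \<beta>)" using has_type_P by simp
  \<comment> \<open>There are two flags for each of the \<open>2 m m^\<beta>\<close> group
    elements.\<close>
  moreover have "tight P (2 * m) (m ^ \<beta>)"
    by (simp add: tight_def card_flags order)
  moreover have "Gamma_is_aut_group_of (int (2 * m)) (int (m ^ \<beta>))
      3 (1 + k * int m ^ (\<beta> - 1)) (-3) (-1 + k * int m ^ (\<beta> - 1)) P"
    using is_aut_group_of_P[OF no_reflection]
    by (simp add: Gamma_is_aut_group_of_def Gamma_def Gamma_gen_def R_def x_def y_def n_def M_def c_def)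
  ultimately show ?thesis using chiral_P[OF no_reflection] by blast
qed

end
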